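(* Assume that for some constants $\gamma\ge 0$ and $\omega'\in[0,\omega)$ one has $$M b e^{\omega\tau}\int_0^t|\alpha(s+\tau)|\,ds\le \gamma+\omega' t\qquad\text{for all } t>0,$$ and that $\int_{t-\tau}^t|\alpha(s)|\,ds\le\sigma$ for all $t\ge 0$, for some $\sigma>0$. There exists $\rho>0$ such that, if the initial data $\Phi=(f_0,g_0)\in C([-\tau,0];\mathcal H)$, with $u_0:=f_0(0)$, $u_1:=g_0(0)$, satisfy $$\|u_1\|^2+\|\sqrt A u_0\|^2+\int_{-\tau}^0\|\nabla\psi_2(f_0(s))\|^2ds+\int_{-\tau}^0|\alpha(s+\tau)|\,\|B^*g_0(s)\|^2ds<\rho^2$$ and $$\max_{s\in[-\tau,0]}\|\Phi(s)\|_{\mathcal H}<\rho,$$ then the problem $$u_{tt}(t)+Au(t)+CC^*u_t(t)+\alpha(t)BB^*u_t(t-\tau)=\nabla\psi_1(u(t))+\nabla\psi_2(u(t-\tau)),\quad t>0,$$ with $u=f_0$, $u_t=g_0$ on $[-\tau,0]$, has a unique global solution, and it satisfies $$E(t)\le\tilde C e^{-(\omega-\omega')t}\qquad\text{for all } t\ge0,$$ where $\tilde C$ is a suitable constant depending on the initial data and $$E(t)=\tfrac12\|u_t(t)\|^2+\tfrac12\|\sqrt A u(t)\|^2-\psi_1(u(t))+\tfrac12\int_{t-\tau}^t\|\nabla\psi_2(u(s))\|^2ds+\tfrac12\int_{t-\tau}^t|\alpha(s+\tau)|\,\|B^*u_t(s)\|^2ds .$$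
   Context: Setting. $H$ is a real Hilbert space with inner product $\langle\cdot,\cdot\rangle$ and norm $\|\cdot\|$; $A:D(A)\to H$ is a positive self-adjoint linear operator with dense domain $D(A)\subset H$; $\tau>0$ is a delay; $W$ is a real Hilbert space identified with its dual; $C:W\to H$ and $B:H\to H$ are bounded linear operators with adjoints $C^*$, $B^*$; $\alpha\in L^1_{loc}([0,+\infty))$ satisfies $\int_{t-\tau}^t|\alpha(s)|ds\le\sigma$ for all $t\ge0$ and some $\sigma>0$ ($\alpha$ being understood as $0$ on negative times). Observability assumption: there are $T_0>0$ and $c>0$ such that every solution of $w_{tt}+Aw+CC^*w_t=0$, $w(0)=w_0$, $w_t(0)=w_1$, satisfies $\int_0^{T_0}\|C^*w_t(t)\|_W^2dt\ge c(\|w_1\|^2+\|\sqrt A w_0\|^2)$. Nonlinearities. $\psi_1,\psi_2:D(\sqrt A)\to\mathbb R$ are functionals with Gateaux derivatives $D\psi_i(u)$, such that: - for every $u\in D(\sqrt A)$ there is $c(u)>0$ with $|D\psi_i(u)(v)|\le c(u)\|v\|$ for all $v\in D(\sqrt A)$, $i=1,2$; then $D\psi_i(u)$ extends to $H$ and $\nabla\psi_i(u)\in H$ denotes its Riesz representative, $\langle\nabla\psi_i(u),v\rangle=D\psi_i(u)(v)$; - for all $R>0$ there is $L(R)>0$ with $\|\nabla\psi_i(u)-\nabla\psi_i(v)\|\le L(R)\|\sqrt A(u-v)\|$ whenever $u,v\in D(\sqrt A)$, $\|\sqrt A u\|\le R$, $\|\sqrt A v\|\le R$, $i=1,2$, and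 $L(R)\to0$ as $R\to0$; - $\psi_i(0)=0$, $\nabla\psi_i(0)=0$ for $i=1,2$, and there is a strictly increasing continuous function $h_1:[0,\infty)\to\mathbb R$ with $|\langle\nabla\psi_1(u),u\rangle|\le h_1(\|\sqrt A u\|)\|\sqrt A u\|^2$ for all $u\in D(\sqrt A)$. Abstract form. $\mathcal H=D(\sqrt A)\times H$ is a Hilbert space with inner product $\langle(u_1,v_1),(u_2,v_2)\rangle_{\mathcal H}=\langle\sqrt A u_1,\sqrt A u_2\rangle+\langle v_1,v_2\rangle$. Put $\mathscr A(u,v)=(v,-Au-CC^*v)$, $\mathscr B(u,v)=(0,-BB^*v)$, and $F(U(t),U(t-\tau))=(0,\nabla\psi_1(u(t))+\nabla\psi_2(u(t-\tau)))$ for $U=(u,v)$, and $b=\|\mathscr B\|=\|BB^*\|$. Under the observability assumption $\mathscr A$ generates an exponentially stable $C_0$-semigroup $(S(t))_{t\ge0}$ on $\mathcal H$; $M,\omega>0$ are fixed constants with $\|S(t)\|_{\mathcal L(\mathcal H)}\le Me^{-\omega t}$ for all $t\ge0$. A solution $u$ of the second-order problem means that $U=(u,u_t)$ is a continuous $\mathcal H$-valued function with $U=\Phi$ on $[-\tau,0]$ and $U(t)=S(t)U_0+\int_0^tS(t-s)[\alpha(s)\mathscr B U(s-\tau)+F(U(s),U(s-\tau))]ds$ for $t\ge0$, where $U_0=U(0)=\Phi(0)$. *)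

theory Defs
  imports "HOL-Analysis.Analysis"
begin

section \<open>Unbounded operators\<close>

text \<open>A partially defined operator is given by its domain \<open>D\<close> and a total function \<open>T\<close> whose values
  outside \<open>D\<close> are irrelevant.\<close>

definition linear_operator :: "'a::real_vector set \<Rightarrow> ('a \<Rightarrow> 'b::real_vector) \<Rightarrow> bool" where
  "linear_operator D T \<longleftrightarrow> subspace D \<and>
     (\<forall>x\<in>D. \<forall>y\<in>D. T (x + y) = T x + T y) \<and> (\<forall>r. \<forall>x\<in>D. T (r *\<^sub>R x) = r *\<^sub>R T x)"

text \<open>The last conjunct says that the graph of the Hilbert space adjoint of \<open>T\<close> is the graph of \<open>T\<close>
  (so in particular both domains agree).\<close>

definition selfadjoint_operator :: "'a::real_inner set \<Rightarrow> ('a \<Rightarrow> 'a) \<Rightarrow> bool" where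
  "selfadjoint_operator D T \<longleftrightarrow> linear_operator D T \<and> closure D = UNIV \<and>
     (\<forall>y z. (\<forall>x\<in>D. T x \<bullet> y = x \<bullet> z) \<longleftrightarrow> (y \<in> D \<and> z = T y))"

definition positive_selfadjoint :: "'a::real_inner set \<Rightarrow> ('a \<Rightarrow> 'a) \<Rightarrow> bool" where
  "positive_selfadjoint D T \<longleftrightarrow> selfadjoint_operator D T \<and> (\<forall>x\<in>D. x \<noteq> 0 \<longrightarrow> 0 < T x \<bullet> x)"

text \<open>\<open>(DV, rA)\<close> is the positive self-adjoint square root of \<open>(DA, A)\<close>; the domain of the composition
  \<open>rA \<circ> rA\<close> is the natural one.\<close>

definition is_sqrt_operator ::
  "'a::real_inner set \<Rightarrow> ('a \<Rightarrow> 'a) \<Rightarrow> 'a set \<Rightarrow> ('a \<Rightarrow> 'a) \<Rightarrow> bool" where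
  "is_sqrt_operator DV rA DA A \<longleftrightarrow> positive_selfadjoint DV rA \<and>
     DA = {x \<in> DV. rA x \<in> DV} \<and> (\<forall>x\<in>DA. A x = rA (rA x))"

section \<open>The energy space\<close>

definition energy_space :: "'a set \<Rightarrow> ('a \<times> 'a) set" where
  "energy_space DV = DV \<times> UNIV"

definition energy_inner :: "('a::real_inner \<Rightarrow> 'a) \<Rightarrow> 'a \<times> 'a \<Rightarrow> 'a \<times> 'a \<Rightarrow> real" where
  "energy_inner rA U V = rA (fst U) \<bullet> rA (fst V) + snd U \<bullet> snd V"

definition energy_norm :: "('a::real_inner \<Rightarrow> 'a) \<Rightarrow> 'a \<times> 'a \<Rightarrow> real" where
  "energy_norm rA U = sqrt (energy_inner rA U U)"

text \<open>The norm of the type \<open>'a \<times> 'a\<close> is not the energy norm. The map \<open>energy_emb rA\<close> is a linear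
  isometry from the energy space into \<open>'a \<times> 'a\<close>; completeness, limits, continuity and integrals
  in the energy space are expressed through it.\<close>

definition energy_emb :: "('a \<Rightarrow> 'a) \<Rightarrow> 'a \<times> 'a \<Rightarrow> 'a \<times> 'a" where
  "energy_emb rA U = (rA (fst U), snd U)"

lemma inner_energy_emb: "energy_emb rA U \<bullet> energy_emb rA V = energy_inner rA U V"
  by (simp add: energy_emb_def energy_inner_def)

lemma norm_energy_emb: "norm (energy_emb rA U) = energy_norm rA U"
  by (simp add: energy_norm_def inner_energy_emb norm_eq_sqrt_inner)

lemma energy_emb_diff:
  assumes "linear_operator DV rA" "U \<in> energy_space DV" "V \<in> energy_space DV"
  shows "energy_emb rA (U - V) = energy_emb rA U - energy_emb rA V"
proof -
  have U: "fst U \<in> DV" and V: "fst V \<in> DV" and D: "subspace DV"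
    using assms by (auto simp: energy_space_def linear_operator_def)
  have "(- 1) *\<^sub>R fst V \<in> DV" using D V by (rule subspace_scale)
  then have "rA (fst U + (- 1) *\<^sub>R fst V) = rA (fst U) + (- 1) *\<^sub>R rA (fst V)"
    using assms(1) U V unfolding linear_operator_def by metis
  then show ?thesis by (simp add: energy_emb_def)
qed

definition energy_continuous_on ::
  "'a::real_inner set \<Rightarrow> ('a \<Rightarrow> 'a) \<Rightarrow> real set \<Rightarrow> (real \<Rightarrow> 'a \<times> 'a) \<Rightarrow> bool" where
  "energy_continuous_on DV rA I U \<longleftrightarrow>
     (\<forall>t\<in>I. U t \<in> energy_space DV) \<and> continuous_on I (\<lambda>t. energy_emb rA (U t))"

text \<open>Henstock--Kurzweil integrals are used because the Bochner integral of the library needs a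
  separable space. Below, all integrands are the sum of a continuous function and of the product
  of a locally integrable scalar function with a continuous function; they are Bochner integrable
  with the same integral.\<close>

definition has_energy_integral ::
  "'a::real_inner set \<Rightarrow> ('a \<Rightarrow> 'a) \<Rightarrow> (real \<Rightarrow> 'a \<times> 'a) \<Rightarrow> 'a \<times> 'a \<Rightarrow> real set \<Rightarrow> bool" where
  "has_energy_integral DV rA G J I \<longleftrightarrow>
     (\<forall>s\<in>I. G s \<in> energy_space DV) \<and> J \<in> energy_space DV \<and>
     ((\<lambda>s. energy_emb rA (G s)) has_integral energy_emb rA J) I"

section \<open>The semigroup of the damped wave equation\<close>

definition energy_C0_semigroup ::
  "'a::real_inner set \<Rightarrow> ('a \<Rightarrow> 'a) \<Rightarrow> (real \<Rightarrow> 'a \<times> 'a \<Rightarrow> 'a \<times> 'a) \<Rightarrow> bool" where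
  "energy_C0_semigroup DV rA S \<longleftrightarrow>
     (\<forall>t\<ge>0. linear_operator (energy_space DV) (S t) \<and> S t ` energy_space DV \<subseteq> energy_space DV \<and>
        (\<exists>K. \<forall>U\<in>energy_space DV. energy_norm rA (S t U) \<le> K * energy_norm rA U)) \<and>
     (\<forall>U\<in>energy_space DV. S 0 U = U \<and> (\<forall>s\<ge>0. \<forall>t\<ge>0. S (s + t) U = S s (S t U)) \<and>
        ((\<lambda>t. energy_emb rA (S t U)) \<longlongrightarrow> energy_emb rA U) (at_right 0))"

definition generates_energy_semigroup ::
  "'a::real_inner set \<Rightarrow> ('a \<Rightarrow> 'a) \<Rightarrow> ('a \<times> 'a) set \<Rightarrow> ('a \<times> 'a \<Rightarrow> 'a \<times> 'a)
     \<Rightarrow> (real \<Rightarrow> 'a \<times> 'a \<Rightarrow> 'a \<times> 'a) \<Rightarrow> bool" where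
  "generates_energy_semigroup DV rA DG G S \<longleftrightarrow> energy_C0_semigroup DV rA S \<and>
     (\<forall>U\<in>energy_space DV. \<forall>V\<in>energy_space DV.
        ((\<lambda>t. energy_emb rA ((1 / t) *\<^sub>R (S t U - U))) \<longlongrightarrow> energy_emb rA V) (at_right 0)
        \<longleftrightarrow> (U \<in> DG \<and> V = G U))"

definition wave_domain :: "'a set \<Rightarrow> 'a set \<Rightarrow> ('a \<times> 'a) set" where
  "wave_domain DA DV = DA \<times> DV"

definition wave_operator ::
  "('a::real_inner \<Rightarrow> 'a) \<Rightarrow> ('w::real_inner \<Rightarrow> 'a) \<Rightarrow> 'a \<times> 'a \<Rightarrow> 'a \<times> 'a" where
  "wave_operator A C U = (snd U, - A (fst U) - C (adjoint C (snd U)))"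

text \<open>The solution of \<open>w\<^sub>t\<^sub>t + A w + C C\<^sup>* w\<^sub>t = 0\<close> with data \<open>W0 = (w\<^sub>0, w\<^sub>1)\<close> in the energy space is
  given by \<open>(w, w\<^sub>t)(t) = S t W0\<close>, where \<open>S\<close> is the semigroup generated by \<open>wave_operator A C\<close>.\<close>

definition observability ::
  "'a::real_inner set \<Rightarrow> ('a \<Rightarrow> 'a) \<Rightarrow> ('w::real_inner \<Rightarrow> 'a) \<Rightarrow> (real \<Rightarrow> 'a \<times> 'a \<Rightarrow> 'a \<times> 'a)
     \<Rightarrow> real \<Rightarrow> real \<Rightarrow> bool" where
  "observability DV rA C S T0 c \<longleftrightarrow>
     (\<forall>w0\<in>DV. \<forall>w1.
        integral {0..T0} (\<lambda>t. (norm (adjoint C (snd (S t (w0, w1)))))\<^sup>2)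
          \<ge> c * ((norm w1)\<^sup>2 + (norm (rA w0))\<^sup>2))"

section \<open>Gateaux derivatives and gradients\<close>

definition gateaux_deriv :: "('a::real_vector \<Rightarrow> real) \<Rightarrow> 'a \<Rightarrow> 'a \<Rightarrow> real" where
  "gateaux_deriv \<psi> u v = Lim (at 0) (\<lambda>h. (\<psi> (u + h *\<^sub>R v) - \<psi> u) / h)"

definition gateaux_differentiable :: "'a::real_vector set \<Rightarrow> ('a \<Rightarrow> real) \<Rightarrow> 'a \<Rightarrow> bool" where
  "gateaux_differentiable D \<psi> u \<longleftrightarrow> linear_operator D (gateaux_deriv \<psi> u) \<and>
     (\<forall>v\<in>D. ((\<lambda>h. (\<psi> (u + h *\<^sub>R v) - \<psi> u) / h) \<longlongrightarrow> gateaux_deriv \<psi> u v) (at 0))"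

text \<open>The Riesz representative in the ambient space of the Gateaux derivative along \<open>D\<close>. It is unique
  if \<open>D\<close> is dense, and it exists if the derivative is bounded in the ambient norm.\<close>

definition gradient_on :: "'a::real_inner set \<Rightarrow> ('a \<Rightarrow> real) \<Rightarrow> 'a \<Rightarrow> 'a" where
  "gradient_on D \<psi> u = (THE g. \<forall>v\<in>D. g \<bullet> v = gateaux_deriv \<psi> u v)"

definition bounded_gateaux :: "'a::real_inner set \<Rightarrow> ('a \<Rightarrow> real) \<Rightarrow> bool" where
  "bounded_gateaux D \<psi> \<longleftrightarrow>
     (\<forall>u\<in>D. gateaux_differentiable D \<psi> u \<and>
        (\<exists>c>0. \<forall>v\<in>D. \<bar>gateaux_deriv \<psi> u v\<bar> \<le> c * norm v))"

definition gradient_lipschitz_with ::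
  "'a::real_inner set \<Rightarrow> ('a \<Rightarrow> 'a) \<Rightarrow> (real \<Rightarrow> real) \<Rightarrow> ('a \<Rightarrow> real) \<Rightarrow> bool" where
  "gradient_lipschitz_with DV rA L \<psi> \<longleftrightarrow>
     (\<forall>R>0. \<forall>u\<in>DV. \<forall>v\<in>DV. norm (rA u) \<le> R \<longrightarrow> norm (rA v) \<le> R \<longrightarrow>
        norm (gradient_on DV \<psi> u - gradient_on DV \<psi> v) \<le> L R * norm (rA (u - v)))"

section \<open>The delayed semilinear problem\<close>

definition delay_operator :: "('a::real_inner \<Rightarrow> 'a) \<Rightarrow> 'a \<times> 'a \<Rightarrow> 'a \<times> 'a" where
  "delay_operator B U = (0, - B (adjoint B (snd U)))"

definition wave_nonlinearity ::
  "'a::real_inner set \<Rightarrow> ('a \<Rightarrow> real) \<Rightarrow> ('a \<Rightarrow> real) \<Rightarrow> 'a \<times> 'a \<Rightarrow> 'a \<times> 'a \<Rightarrow> 'a \<times> 'a" where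
  "wave_nonlinearity DV \<psi>1 \<psi>2 U V =
     (0, gradient_on DV \<psi>1 (fst U) + gradient_on DV \<psi>2 (fst V))"

text \<open>Only the values of \<open>U\<close> on \<open>[-\<tau>, \<infinity>)\<close> matter. The second component of \<open>U\<close> is \<open>u\<^sub>t\<close>: on \<open>[-\<tau>, 0]\<close> it
  is prescribed by the history, and for \<open>t \<ge> 0\<close> it is the derivative of \<open>u\<close> in the ambient space
  (one-sided at \<open>0\<close>).\<close>

definition is_mild_solution ::
  "'a::real_inner set \<Rightarrow> ('a \<Rightarrow> 'a) \<Rightarrow> (real \<Rightarrow> 'a \<times> 'a \<Rightarrow> 'a \<times> 'a) \<Rightarrow> ('a \<Rightarrow> 'a)
     \<Rightarrow> ('a \<Rightarrow> real) \<Rightarrow> ('a \<Rightarrow> real) \<Rightarrow> (real \<Rightarrow> real) \<Rightarrow> real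
     \<Rightarrow> (real \<Rightarrow> 'a \<times> 'a) \<Rightarrow> (real \<Rightarrow> 'a \<times> 'a) \<Rightarrow> bool" where
  "is_mild_solution DV rA S B \<psi>1 \<psi>2 \<alpha> \<tau> \<Phi> U \<longleftrightarrow>
     energy_continuous_on DV rA {-\<tau>..} U \<and>
     (\<forall>t\<in>{-\<tau>..0}. U t = \<Phi> t) \<and>
     (\<forall>t\<ge>0. ((\<lambda>s. fst (U s)) has_vector_derivative snd (U t)) (at t within {0..})) \<and>
     (\<forall>t\<ge>0. has_energy_integral DV rA
        (\<lambda>s. S (t - s) (\<alpha> s *\<^sub>R delay_operator B (U (s - \<tau>))
                          + wave_nonlinearity DV \<psi>1 \<psi>2 (U s) (U (s - \<tau>))))
        (U t - S t (U 0)) {0..t})"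

definition delay_energy ::
  "'a::real_inner set \<Rightarrow> ('a \<Rightarrow> 'a) \<Rightarrow> ('a \<Rightarrow> 'a) \<Rightarrow> ('a \<Rightarrow> real) \<Rightarrow> ('a \<Rightarrow> real)
     \<Rightarrow> (real \<Rightarrow> real) \<Rightarrow> real \<Rightarrow> (real \<Rightarrow> 'a \<times> 'a) \<Rightarrow> real \<Rightarrow> real" where
  "delay_energy DV rA B \<psi>1 \<psi>2 \<alpha> \<tau> U t =
     1/2 * (norm (snd (U t)))\<^sup>2 + 1/2 * (norm (rA (fst (U t))))\<^sup>2 - \<psi>1 (fst (U t))
     + 1/2 * integral {t - \<tau>..t} (\<lambda>s. (norm (gradient_on DV \<psi>2 (fst (U s))))\<^sup>2)
     + 1/2 * integral {t - \<tau>..t} (\<lambda>s. \<bar>\<alpha> (s + \<tau>)\<bar> * (norm (adjoint B (snd (U s))))\<^sup>2)"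

end

theory Submission
  imports Defs
begin

text \<open>
  Write \<open>U = (u, u\<^sub>t)\<close>, \<open>b = \<parallel>B B\<^sup>*\<parallel>\<close>, and let \<open>\<eta> = L(R)\<close> be the Lipschitz constant of the gradients on the
  ball of radius \<open>R\<close> in the energy norm. The proof reads existence, uniqueness and decay off the
  Duhamel formula. As long as \<open>U\<close> stays in the ball, the decay of the semigroup gives
    \<open>\<parallel>U(t)\<parallel> e\<^sup>\<omega>\<^sup>t \<le> M \<parallel>U(0)\<parallel> + \<integral>\<^sub>-\<^sub>\<tau>\<^sup>t k(s) \<parallel>U(s)\<parallel> e\<^sup>\<omega>\<^sup>s ds\<close>
  with \<open>k(s) = M exp(\<omega> \<tau>) (b \<bar>\<alpha>(s + \<tau>)\<bar> + \<eta>) + M \<eta>\<close>; the delayed values have been booked at the time when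
  they were taken. Let \<open>K(t)\<close> be the integral of \<open>k\<close> over \<open>[-\<tau>, t]\<close>. The integral of \<open>k exp(\<kappa> K)\<close> is at most
  \<open>(exp(\<kappa> K) - 1) / \<kappa>\<close> (\<open>integral_exp_integral_le\<close>, \<open>duhamel_bound\<close>). For \<open>\<kappa> = 1\<close> this shows that the
  Picard map preserves the set \<open>\<parallel>U(t)\<parallel> \<le> c exp(K(t) - \<omega> t)\<close>. For \<open>\<kappa> = 2\<close> it shows that the map contracts
  distances by \<open>1/2\<close> in the norm weighted by \<open>exp(2 K(t) - \<omega> t)\<close>, which yields a global solution
  (\<open>mild_solution_exists\<close>) and also uniqueness (\<open>mild_solution_unique\<close>).

  The growth hypothesis on \<open>\<alpha>\<close> gives \<open>K(t) - \<omega> t \<le> const - (\<omega> - \<omega>' - M \<eta> (1 + exp(\<omega> \<tau>))) t\<close>. Since \<open>L(R)\<close>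
  tends to \<open>0\<close> with \<open>R\<close>, the radius can be chosen such that the last bracket is at least
  \<open>(\<omega> - \<omega>') / 2\<close>, and then \<open>\<rho>\<close> such that the invariant set lies in the ball of radius \<open>R\<close>. So
  \<open>\<parallel>U(t)\<parallel>\<^sup>2\<close> decays at least like \<open>exp(- (\<omega> - \<omega>') t)\<close>, and the energy is controlled by the values of
  \<open>\<parallel>U\<parallel>\<^sup>2\<close> on \<open>[t - \<tau>, t]\<close> (\<open>delay_energy_decay\<close>).

  Two points connect this to the wave equation. First, the square root of \<open>A\<close> is onto and has a bounded
  inverse \<open>T\<close> (\<open>sqrt_operator_inverse\<close>), so that \<open>(u, v) \<mapsto> (rA u, v)\<close> identifies the energy space with
  the full product space, and the evolution can be studied in a Banach space. Second, the mild solution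
  must satisfy \<open>u\<^sub>t = v\<close> in the ambient norm; this follows from the structure of the generator on time
  integrals of orbits (\<open>transported_semigroup\<close>, \<open>mild_solution_kinematics\<close>).
\<close>

section \<open>Products of integrable scalars and continuous vectors\<close>

text \<open>The integrand may be unbounded, so that uniform approximation by integrable functions is not
  available; the error is allowed to be a small multiple of a fixed integrable function instead,
  whose Riemann sums stay bounded along a fine gauge. The Cauchy criterion then passes from the
  approximants to \<open>f\<close>.\<close>

lemma integrable_approx_weighted:
  fixes f :: "real \<Rightarrow> 'b::banach" and \<phi> :: "real \<Rightarrow> real"
  assumes \<phi>: "\<phi> integrable_on {a..b}"
    and approx: "\<And>e. e > 0 \<Longrightarrow> \<exists>g. g integrable_on {a..b} \<and> (\<forall>s\<in>{a..b}. norm (f s - g s) \<le> e * \<phi> s)"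
  shows "f integrable_on {a..b}"
proof -
  have "\<exists>\<gamma>. gauge \<gamma> \<and>
          (\<forall>\<D>1 \<D>2. \<D>1 tagged_division_of (cbox a b) \<and> \<gamma> fine \<D>1 \<and>
            \<D>2 tagged_division_of (cbox a b) \<and> \<gamma> fine \<D>2 \<longrightarrow>
            norm ((\<Sum>(x,K)\<in>\<D>1. measure lborel K *\<^sub>R f x) - (\<Sum>(x,K)\<in>\<D>2. measure lborel K *\<^sub>R f x)) < e)"
    if "e > 0" for e
  proof -
    define J where "J = integral {a..b} \<phi>"
    define d where "d = e / (4 * (\<bar>J\<bar> + 1))"
    have d: "d > 0" using that by (simp add: d_def)
    have dJ: "d * (J + 1) \<le> e / 4"
    proof -
      have "d * (J + 1) \<le> d * (\<bar>J\<bar> + 1)" using d by (intro mult_left_mono) auto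
      also have "\<dots> = e / 4" by (simp add: d_def field_simps)
      finally show ?thesis .
    qed
    obtain g where g: "g integrable_on {a..b}"
      and fg: "\<And>s. s \<in> {a..b} \<Longrightarrow> norm (f s - g s) \<le> d * \<phi> s"
      using approx[OF d] by blast
    obtain \<gamma>1 where \<gamma>1: "gauge \<gamma>1"
      and fine1: "\<And>\<D>1 \<D>2. \<lbrakk>\<D>1 tagged_division_of cbox a b; \<gamma>1 fine \<D>1;
            \<D>2 tagged_division_of cbox a b; \<gamma>1 fine \<D>2\<rbrakk> \<Longrightarrow>
            norm ((\<Sum>(x,K)\<in>\<D>1. measure lborel K *\<^sub>R g x) - (\<Sum>(x,K)\<in>\<D>2. measure lborel K *\<^sub>R g x)) < e / 4"
    proof -
      have "g integrable_on cbox a b" using g by simp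
      then have "\<exists>\<gamma>. gauge \<gamma> \<and>
          (\<forall>\<D>1 \<D>2. \<D>1 tagged_division_of (cbox a b) \<and> \<gamma> fine \<D>1 \<and>
            \<D>2 tagged_division_of (cbox a b) \<and> \<gamma> fine \<D>2 \<longrightarrow>
            norm ((\<Sum>(x,K)\<in>\<D>1. measure lborel K *\<^sub>R g x) - (\<Sum>(x,K)\<in>\<D>2. measure lborel K *\<^sub>R g x)) < e / 4)"
        unfolding integrable_Cauchy using \<open>e > 0\<close> by (elim allE[of _ "e / 4"]) simp
      then show ?thesis by (elim exE conjE) (rule that, assumption, simp)
    qed
    have "(\<phi> has_integral J) (cbox a b)"
      using \<phi> by (simp add: J_def integrable_integral)
    then obtain \<gamma>2 where \<gamma>2: "gauge \<gamma>2"
      and fine2: "\<And>\<D>. \<lbrakk>\<D> tagged_division_of cbox a b; \<gamma>2 fine \<D>\<rbrakk> \<Longrightarrow>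
            norm ((\<Sum>(x,K)\<in>\<D>. measure lborel K *\<^sub>R \<phi> x) - J) < 1"
      unfolding has_integral by (metis zero_less_one)
    show ?thesis
    proof (intro exI[of _ "\<lambda>x. \<gamma>1 x \<inter> \<gamma>2 x"] conjI allI impI gauge_Int \<gamma>1 \<gamma>2)
      fix \<D>1 \<D>2
      assume D: "\<D>1 tagged_division_of (cbox a b) \<and> (\<lambda>x. \<gamma>1 x \<inter> \<gamma>2 x) fine \<D>1 \<and>
            \<D>2 tagged_division_of (cbox a b) \<and> (\<lambda>x. \<gamma>1 x \<inter> \<gamma>2 x) fine \<D>2"
      have est: "norm ((\<Sum>(x,K)\<in>\<D>. measure lborel K *\<^sub>R f x) - (\<Sum>(x,K)\<in>\<D>. measure lborel K *\<^sub>R g x)) \<le> e / 4"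
        if tag: "\<D> tagged_division_of cbox a b" and fine: "\<gamma>2 fine \<D>" for \<D>
      proof -
        have "(\<Sum>(x,K)\<in>\<D>. measure lborel K *\<^sub>R f x) - (\<Sum>(x,K)\<in>\<D>. measure lborel K *\<^sub>R g x)
            = (\<Sum>(x,K)\<in>\<D>. measure lborel K *\<^sub>R (f x - g x))"
          by (simp add: split_def scaleR_diff_right sum_subtractf)
        also have "norm \<dots> \<le> (\<Sum>(x,K)\<in>\<D>. measure lborel K *\<^sub>R (d * \<phi> x))"
        proof (rule sum_norm_le)
          fix xK assume xK: "xK \<in> \<D>"
          obtain x K where [simp]: "xK = (x, K)" by force
          have "x \<in> {a..b}" using tag xK by (metis \<open>xK = (x, K)\<close> box_real(2) tag_in_interval)
          then show "norm (case xK of (x, K) \<Rightarrow> measure lborel K *\<^sub>R (f x - g x))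
              \<le> (case xK of (x, K) \<Rightarrow> measure lborel K *\<^sub>R (d * \<phi> x))"
            using fg by (auto intro!: mult_left_mono)
        qed
        also have "\<dots> = d * (\<Sum>(x,K)\<in>\<D>. measure lborel K *\<^sub>R \<phi> x)"
          by (simp add: sum_distrib_left split_def algebra_simps)
        also have "\<dots> \<le> d * (J + 1)"
          using fine2[OF tag fine] d by (intro mult_left_mono) (auto simp: abs_less_iff)
        finally show ?thesis using dJ by linarith
      qed
      have fine: "\<gamma>1 fine \<D>1" "\<gamma>2 fine \<D>1" "\<gamma>1 fine \<D>2" "\<gamma>2 fine \<D>2"
        and tag: "\<D>1 tagged_division_of cbox a b" "\<D>2 tagged_division_of cbox a b"
        using D by (auto simp: fine_Int)
      note fine1[OF tag(1) fine(1) tag(2) fine(3)] est[OF tag(1) fine(2)] est[OF tag(2) fine(4)]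
      then show "norm ((\<Sum>(x,K)\<in>\<D>1. measure lborel K *\<^sub>R f x) - (\<Sum>(x,K)\<in>\<D>2. measure lborel K *\<^sub>R f x)) < e"
        using that by norm
    qed
  qed
  then show ?thesis
    unfolding box_real[symmetric] integrable_Cauchy by blast
qed

text \<open>A continuous \<open>h\<close> is locally almost constant, and a scalar integrable function times a constant
  vector is integrable. Subdividing the interval yields approximants whose error is small
  relative to \<open>\<bar>a\<bar>\<close>. The argument covers nonseparable targets, as the energy space is an arbitrary
  Hilbert space.\<close>

lemma integrable_scaleR_continuous:
  fixes h :: "real \<Rightarrow> 'b::banach" and a :: "real \<Rightarrow> real"
  assumes a: "a absolutely_integrable_on {l..r}" and h: "continuous_on {l..r} h"
  shows "(\<lambda>s. a s *\<^sub>R h s) integrable_on {l..r}"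
proof (cases "l \<le> r")
  case True
  have abs_int: "(\<lambda>s. \<bar>a s\<bar>) integrable_on {l..r}" and int: "a integrable_on {l..r}"
    using a by (auto simp: absolutely_integrable_on_def)
  show ?thesis
  proof (rule integrable_approx_weighted[OF abs_int])
    fix e :: real assume "e > 0"
    define P where "P u v \<longleftrightarrow> (l \<le> u \<and> v \<le> r \<longrightarrow> (\<exists>g. g integrable_on {u..v} \<and>
        (\<forall>s\<in>{u..v}. norm (a s *\<^sub>R h s - g s) \<le> e * \<bar>a s\<bar>)))" for u v
    have "P l r"
      using True
    proof (induct rule: Bolzano)
      case (trans u v w)
      show ?case unfolding P_def
      proof
        assume lr: "l \<le> u \<and> w \<le> r"
        obtain g1 g2 where g1: "g1 integrable_on {u..v}"
          "\<And>s. s \<in> {u..v} \<Longrightarrow> norm (a s *\<^sub>R h s - g1 s) \<le> e * \<bar>a s\<bar>"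
          and g2: "g2 integrable_on {v..w}"
          "\<And>s. s \<in> {v..w} \<Longrightarrow> norm (a s *\<^sub>R h s - g2 s) \<le> e * \<bar>a s\<bar>"
          using trans lr by (auto simp: P_def)
        define g where "g s = (if s \<le> v then g1 s else g2 s)" for s
        have "g integrable_on {u..v}"
          using g1(1) by (rule integrable_eq) (auto simp: g_def)
        moreover have "g integrable_on {v..w}"
          by (rule integrable_spike_finite[OF _ _ g2(1), of "{v}"]) (auto simp: g_def)
        ultimately have "g integrable_on {u..w}"
          by (rule Henstock_Kurzweil_Integration.integrable_combine[OF trans(3,4)])
        moreover have "norm (a s *\<^sub>R h s - g s) \<le> e * \<bar>a s\<bar>" if "s \<in> {u..w}" for s
          using that g1(2)[of s] g2(2)[of s] by (auto simp: g_def)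
        ultimately show "\<exists>g. g integrable_on {u..w} \<and>
            (\<forall>s\<in>{u..w}. norm (a s *\<^sub>R h s - g s) \<le> e * \<bar>a s\<bar>)" by blast
      qed
    next
      case (local x)
      then obtain d where d: "d > 0" "\<And>s. s \<in> {l..r} \<Longrightarrow> dist s x < d \<Longrightarrow> dist (h s) (h x) < e"
        using h \<open>e > 0\<close> unfolding continuous_on_iff by (metis atLeastAtMost_iff)
      show ?case
      proof (intro exI[of _ d] conjI d(1) allI impI)
        fix u v assume uv: "u \<le> x \<and> x \<le> v \<and> v - u < d"
        show "P u v" unfolding P_def
        proof (intro impI exI[of _ "\<lambda>s. a s *\<^sub>R h x"] conjI ballI)
          assume lr: "l \<le> u \<and> v \<le> r"
          show "(\<lambda>s. a s *\<^sub>R h x) integrable_on {u..v}"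
            using integrable_subinterval_real[OF int, of u v] lr
            by (intro integrable_on_scaleR_left) auto
          fix s assume s: "s \<in> {u..v}"
          have "\<bar>s - x\<bar> < d" "s \<in> {l..r}" using s uv lr by auto
          then have "norm (h s - h x) \<le> e"
            using d(2)[of s] by (auto simp: dist_norm)
          then show "norm (a s *\<^sub>R h s - a s *\<^sub>R h x) \<le> e * \<bar>a s\<bar>"
            using mult_left_mono[OF _ abs_ge_zero[of "a s"], of "norm (h s - h x)" e]
            by (metis mult.commute norm_scaleR real_norm_def scaleR_diff_right)
        qed
      qed
    qed
    then show "\<exists>g. g integrable_on {l..r} \<and> (\<forall>s\<in>{l..r}. norm (a s *\<^sub>R h s - g s) \<le> e * \<bar>a s\<bar>)"
      by (simp add: P_def)
  qed
qed auto

text \<open>The chain rule \<open>(exp (\<kappa> K))' = \<kappa> k exp (\<kappa> K)\<close> in integrated form. As \<open>k\<close> is merely integrable,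
  it is proved without derivatives: on intervals where \<open>K\<close> varies little, the integral exceeds the
  increment of \<open>exp (\<kappa> K) / \<kappa>\<close> at most by a factor \<open>c\<close> close to \<open>1\<close>, this property is additive
  over adjacent intervals, and \<open>c\<close> tends to \<open>1\<close>. Used with \<open>\<kappa> = 1\<close> and \<open>\<kappa> = 2\<close>, it plays the
  role of Gronwall's inequality.\<close>

lemma integral_exp_integral_le:
  fixes k :: "real \<Rightarrow> real"
  assumes k: "k integrable_on {a..b}" and k_nonneg: "\<And>s. s \<in> {a..b} \<Longrightarrow> 0 \<le> k s"
    and "a \<le> b" and "\<kappa> > 0"
  defines "K \<equiv> \<lambda>t. integral {a..t} k"
  shows "(\<lambda>s. k s * exp (\<kappa> * K s)) integrable_on {a..b}" (is ?int)
    and "integral {a..b} (\<lambda>s. k s * exp (\<kappa> * K s)) \<le> (exp (\<kappa> * K b) - 1) / \<kappa>" (is ?le)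
proof -
  define f where "f s = k s * exp (\<kappa> * K s)" for s
  have K_cont: "continuous_on {a..b} K"
    unfolding K_def by (rule indefinite_integral_continuous_1[OF k])
  have "k absolutely_integrable_on {a..b}"
    using k k_nonneg by (auto intro: nonnegative_absolutely_integrable_1)
  from integrable_scaleR_continuous[OF this, of "\<lambda>s. exp (\<kappa> * K s)"]
  have f_int: "f integrable_on {a..b}"
    using K_cont by (simp add: f_def[abs_def] continuous_on_exp continuous_on_mult_left)
  then show ?int by (simp add: f_def[abs_def])
  have K_diff: "K v - K u = integral {u..v} k" if "a \<le> u" "u \<le> v" "v \<le> b" for u v
    using Henstock_Kurzweil_Integration.integral_combine[OF that(1,2) integrable_subinterval_real[OF k]] that
    by (auto simp: K_def)
  have K_mono: "K u \<le> K v" if "a \<le> u" "u \<le> v" "v \<le> b" for u v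
    using K_diff[OF that] integral_nonneg[OF integrable_subinterval_real[OF k], of u v] that k_nonneg
    by force
  have step: "integral {a..b} f \<le> c * ((exp (\<kappa> * K b) - exp (\<kappa> * K a)) / \<kappa>)" if "c > 1" for c
  proof -
    define P where "P u v \<longleftrightarrow> (a \<le> u \<and> v \<le> b \<longrightarrow>
      integral {u..v} f \<le> c * ((exp (\<kappa> * K v) - exp (\<kappa> * K u)) / \<kappa>))" for u v
    have "P a b"
      using \<open>a \<le> b\<close>
    proof (induct rule: Bolzano)
      case (trans u v w)
      show ?case unfolding P_def
      proof
        assume "a \<le> u \<and> w \<le> b"
        then have "integral {u..w} f = integral {u..v} f + integral {v..w} f"
          using trans by (intro Henstock_Kurzweil_Integration.integral_combine[symmetric] integrable_subinterval_real[OF f_int]) auto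
        also have "\<dots> \<le> c * ((exp (\<kappa> * K v) - exp (\<kappa> * K u)) / \<kappa>) + c * ((exp (\<kappa> * K w) - exp (\<kappa> * K v)) / \<kappa>)"
          using trans \<open>a \<le> u \<and> w \<le> b\<close> by (intro add_mono) (auto simp: P_def)
        also have "\<dots> = c * ((exp (\<kappa> * K w) - exp (\<kappa> * K u)) / \<kappa>)"
          by (simp add: diff_divide_distrib algebra_simps)
        finally show "integral {u..w} f \<le> \<dots>" .
      qed
    next
      case (local x)
      define e where "e = ln c / (2 * \<kappa>)"
      have "e > 0" using that \<open>\<kappa> > 0\<close> by (simp add: e_def)
      then obtain d where d: "d > 0" "\<And>s. s \<in> {a..b} \<Longrightarrow> dist s x < d \<Longrightarrow> dist (K s) (K x) < e"
        using K_cont local unfolding continuous_on_iff by (metis atLeastAtMost_iff)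
      show ?case
      proof (intro exI[of _ d] conjI d(1) allI impI)
        fix u v assume uv: "u \<le> x \<and> x \<le> v \<and> v - u < d"
        show "P u v" unfolding P_def
        proof
          assume ab: "a \<le> u \<and> v \<le> b"
          define D where "D = K v - K u"
          have "D \<ge> 0" using K_mono[of u v] uv ab by (auto simp: D_def)
          have "D \<le> 2 * e"
            using d(2)[of u] d(2)[of v] uv ab by (auto simp: D_def dist_real_def)
          then have "exp (\<kappa> * D) \<le> c"
            using \<open>\<kappa> > 0\<close> that by (simp add: e_def ln_ge_iff[symmetric] field_simps)
          \<comment> \<open>\<open>K\<close> is monotone, so that \<open>exp (\<kappa> K)\<close> is at most its right end value, which is
            at most \<open>c\<close> times its left end value.\<close>
          have "integral {u..v} f \<le> integral {u..v} (\<lambda>s. k s * exp (\<kappa> * K v))"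
          proof (rule integral_le)
            show "f integrable_on {u..v}"
              using ab by (intro integrable_subinterval_real[OF f_int]) auto
            show "(\<lambda>s. k s * exp (\<kappa> * K v)) integrable_on {u..v}"
              using ab by (intro integrable_on_mult_left integrable_subinterval_real[OF k]) auto
            fix s assume "s \<in> {u..v}"
            then show "f s \<le> k s * exp (\<kappa> * K v)"
              using ab k_nonneg[of s] K_mono[of s v] \<open>\<kappa> > 0\<close> by (auto simp: f_def intro!: mult_left_mono)
          qed
          also have "\<dots> = D * exp (\<kappa> * K v)"
            using K_diff[of u v] uv ab by (simp add: D_def)
          also have "\<dots> = D * exp (\<kappa> * K u) * exp (\<kappa> * D)"
            by (simp add: D_def exp_add[symmetric] algebra_simps)
          also have "\<dots> \<le> D * exp (\<kappa> * K u) * c"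
            using \<open>exp (\<kappa> * D) \<le> c\<close> \<open>D \<ge> 0\<close> by (intro mult_left_mono) auto
          also have "\<dots> = c * (exp (\<kappa> * K u) * (\<kappa> * D) / \<kappa>)"
            using \<open>\<kappa> > 0\<close> by (simp add: field_simps)
          also have "\<dots> \<le> c * (exp (\<kappa> * K u) * (exp (\<kappa> * D) - 1) / \<kappa>)"
          proof -
            have "\<kappa> * D \<le> exp (\<kappa> * D) - 1"
              using exp_ge_add_one_self[of "\<kappa> * D"] by linarith
            then show ?thesis
              using that \<open>\<kappa> > 0\<close> by (intro mult_left_mono divide_right_mono) auto
          qed
          also have "exp (\<kappa> * K u) * (exp (\<kappa> * D) - 1) = exp (\<kappa> * K v) - exp (\<kappa> * K u)"
            by (simp add: D_def algebra_simps exp_add[symmetric])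
          finally show "integral {u..v} f \<le> c * ((exp (\<kappa> * K v) - exp (\<kappa> * K u)) / \<kappa>)" .
        qed
      qed
    qed
    then show ?thesis by (simp add: P_def)
  qed
  have lim: "((\<lambda>c. c * ((exp (\<kappa> * K b) - exp (\<kappa> * K a)) / \<kappa>)) \<longlongrightarrow>
      1 * ((exp (\<kappa> * K b) - exp (\<kappa> * K a)) / \<kappa>)) (at_right 1)"
    by (intro tendsto_intros)
  have "integral {a..b} f \<le> 1 * ((exp (\<kappa> * K b) - exp (\<kappa> * K a)) / \<kappa>)"
  proof (rule tendsto_lowerbound[OF lim])
    show "eventually (\<lambda>c. integral {a..b} f \<le> c * ((exp (\<kappa> * K b) - exp (\<kappa> * K a)) / \<kappa>)) (at_right 1)"
      using eventually_at_right_less by (rule eventually_mono) (rule step)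
  qed simp
  then show ?le by (simp add: f_def[abs_def] K_def)
qed

text \<open>The integral of a non-integrable function is \<open>0\<close> by convention, so that a nonnegative majorant
  suffices even if \<open>f\<close> is not known to be integrable.\<close>

lemma integral_le_nonneg_bound:
  fixes f g :: "real \<Rightarrow> real"
  assumes "g integrable_on I" "\<And>s. s \<in> I \<Longrightarrow> f s \<le> g s" "\<And>s. s \<in> I \<Longrightarrow> 0 \<le> g s"
  shows "integral I f \<le> integral I g"
proof (cases "f integrable_on I")
  case True
  then show ?thesis using assms by (intro integral_le) auto
next
  case False
  then show ?thesis using assms by (simp add: not_integrable_integral integral_nonneg)
qed

section \<open>Hilbert space preliminaries\<close>

text \<open>The functional \<open>J\<close> below is bounded from below on \<open>D\<close>, a minimising sequence is Cauchy by the
  parallelogram identity, and the first variation of \<open>J\<close> vanishes at the limit. Working on a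
  subspace that need not be closed covers three uses: adjoints (\<open>D = UNIV\<close>), gradients of
  functionals defined on a dense subspace, and orthogonal projection onto a closed subspace.\<close>

lemma riesz_representation_subspace:
  fixes D :: "'a::{real_inner, banach} set" and f :: "'a \<Rightarrow> real"
  assumes D: "subspace D"
    and add: "\<And>x y. x \<in> D \<Longrightarrow> y \<in> D \<Longrightarrow> f (x + y) = f x + f y"
    and scale: "\<And>r x. x \<in> D \<Longrightarrow> f (r *\<^sub>R x) = r * f x"
    and bound: "\<And>x. x \<in> D \<Longrightarrow> \<bar>f x\<bar> \<le> c * norm x"
  obtains g where "g \<in> closure D" "\<And>v. v \<in> D \<Longrightarrow> g \<bullet> v = f v"
proof -
  define J where "J v = (norm v)\<^sup>2 - 2 * f v" for v
  have J_lower: "- c\<^sup>2 \<le> J v" if "v \<in> D" for v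
  proof -
    have "0 \<le> (norm v - c)\<^sup>2" by simp
    then have "2 * (c * norm v) \<le> (norm v)\<^sup>2 + c\<^sup>2" by (simp add: power2_diff algebra_simps)
    then show ?thesis using bound[OF that] by (simp add: J_def abs_le_iff)
  qed
  have D_ne: "J ` D \<noteq> {}" and J_bdd: "bdd_below (J ` D)"
    using subspace_0[OF D] bdd_belowI2[of D "- c\<^sup>2" J, OF J_lower] by auto
  define m where "m = Inf (J ` D)"
  have m_le: "m \<le> J v" if "v \<in> D" for v
    unfolding m_def using that J_bdd by (intro cInf_lower) auto
  have "\<exists>v\<in>D. J v < m + 1 / real (Suc n)" for n
  proof -
    have "m < m + 1 / real (Suc n)" by simp
    then show ?thesis unfolding m_def using D_ne J_bdd by (subst (asm) cInf_less_iff) auto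
  qed
  then obtain v where vD: "\<And>n. v n \<in> D" and v_min: "\<And>n. J (v n) < m + 1 / real (Suc n)"
    by metis
  have J_conv: "(norm (x - y))\<^sup>2 \<le> 2 * (J x - m) + 2 * (J y - m)" if "x \<in> D" "y \<in> D" for x y
  proof -
    \<comment> \<open>The parallelogram identity at the midpoint, where \<open>J\<close> is at least \<open>m\<close>.\<close>
    have mid: "(1/2) *\<^sub>R (x + y) \<in> D" using D that by (intro subspace_scale subspace_add)
    have "f ((1/2) *\<^sub>R (x + y)) = (1/2) * (f x + f y)"
      using that D by (simp add: scale add subspace_add)
    moreover have "norm ((1/2) *\<^sub>R (x + y)) = norm (x + y) / 2" by simp
    ultimately have "4 * J ((1/2) *\<^sub>R (x + y)) = (norm (x + y))\<^sup>2 - 4 * (f x + f y)"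
      unfolding J_def by (simp only: power_divide) (simp add: field_simps)
    moreover have "(norm (x + y))\<^sup>2 + (norm (x - y))\<^sup>2 = 2 * (norm x)\<^sup>2 + 2 * (norm y)\<^sup>2"
      by (simp add: power2_norm_eq_inner inner_simps inner_commute)
    ultimately show ?thesis using m_le[OF mid] by (simp add: J_def)
  qed
  have "Cauchy v"
  proof (rule metric_CauchyI)
    fix e :: real assume "e > 0"
    then obtain N where N: "1 / real (Suc N) < e\<^sup>2 / 4"
      using reals_Archimedean[of "e\<^sup>2 / 4"] by (auto simp: inverse_eq_divide)
    show "\<exists>N. \<forall>i\<ge>N. \<forall>j\<ge>N. dist (v i) (v j) < e"
    proof (intro exI[of _ N] allI impI)
      fix i j assume "i \<ge> N" "j \<ge> N"
      have *: "J (v k) - m < e\<^sup>2 / 4" if "k \<ge> N" for k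
      proof -
        have "1 / real (Suc k) \<le> 1 / real (Suc N)" using that by (intro divide_left_mono) auto
        then show ?thesis using v_min[of k] N by linarith
      qed
      have "(norm (v i - v j))\<^sup>2 < e\<^sup>2"
        using J_conv[OF vD[of i] vD[of j]] *[OF \<open>i \<ge> N\<close>] *[OF \<open>j \<ge> N\<close>] by argo
      then show "dist (v i) (v j) < e"
        using \<open>e > 0\<close> by (simp add: dist_norm power_less_imp_less_base)
    qed
  qed
  then obtain g where g: "v \<longlonglongrightarrow> g" using Cauchy_convergent convergent_def by blast
  have "g \<bullet> w = f w" if w: "w \<in> D" for w
  proof -
    have lim: "(\<lambda>n. 1 / real (Suc n)) \<longlonglongrightarrow> 0" using LIMSEQ_inverse_real_of_nat by (simp add: inverse_eq_divide)
    have quad: "0 \<le> 2 * t * (g \<bullet> w - f w) + t\<^sup>2 * (norm w)\<^sup>2" for t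
    proof (rule LIMSEQ_le_const)
      show "(\<lambda>n. 1 / real (Suc n) + (2 * t * (v n \<bullet> w - f w) + t\<^sup>2 * (norm w)\<^sup>2))
          \<longlonglongrightarrow> 2 * t * (g \<bullet> w - f w) + t\<^sup>2 * (norm w)\<^sup>2"
        by (rule tendsto_eq_intros lim g | simp)+
      have "J (v n + t *\<^sub>R w) = J (v n) + (2 * t * (v n \<bullet> w - f w) + t\<^sup>2 * (norm w)\<^sup>2)" for n
      proof -
        have "(norm (v n + t *\<^sub>R w))\<^sup>2 = (norm (v n))\<^sup>2 + 2 * t * (v n \<bullet> w) + t\<^sup>2 * (norm w)\<^sup>2"
          by (simp add: power2_norm_eq_inner inner_simps inner_commute power2_eq_square[of t] algebra_simps)
        then show ?thesis
          using vD[of n] w D by (simp add: J_def add scale subspace_scale algebra_simps)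
      qed
      moreover have "m \<le> J (v n + t *\<^sub>R w)" for n
        using vD[of n] w D by (intro m_le subspace_add subspace_scale)
      ultimately show "\<exists>N. \<forall>n\<ge>N. 0 \<le> 1 / real (Suc n) + (2 * t * (v n \<bullet> w - f w) + t\<^sup>2 * (norm w)\<^sup>2)"
        using v_min by (intro exI[of _ 0] allI impI) (smt (verit))
    qed
    define d where "d = g \<bullet> w - f w"
    define n where "n = (norm w)\<^sup>2 + 1"
    have "n > 0" by (simp add: n_def add_nonneg_pos)
    have "0 \<le> 2 * (- d / n) * d + (- d / n)\<^sup>2 * (norm w)\<^sup>2" using quad[of "- d / n"] by (simp add: d_def)
    also have "\<dots> \<le> 2 * (- d / n) * d + (- d / n)\<^sup>2 * n"
      by (intro add_left_mono mult_left_mono) (auto simp: n_def)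
    also have "\<dots> = - d\<^sup>2 / n" using \<open>n > 0\<close> by (simp add: field_simps power2_eq_square)
    finally have "d = 0" using \<open>n > 0\<close> by (simp add: divide_le_0_iff field_simps)
    then show ?thesis by (simp add: d_def)
  qed
  moreover have "g \<in> closure D" using g vD closure_sequential by blast
  ultimately show ?thesis using that by blast
qed

text \<open>The library function \<open>adjoint\<close> chooses an adjoint if there is one; for a bounded operator on a
  Hilbert space the Riesz representation provides it.\<close>

lemma adjoint_hilbert:
  fixes B :: "'a::{real_inner, banach} \<Rightarrow> 'b::real_inner"
  assumes B: "bounded_linear B"
  shows "B x \<bullet> y = x \<bullet> adjoint B y" and "bounded_linear (adjoint B)"
proof -
  interpret B: bounded_linear B by (rule B)
  obtain c where c: "\<And>x. norm (B x) \<le> norm x * c" and "c > 0" using B.pos_bounded by blast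
  have "\<exists>z. \<forall>x. B x \<bullet> y = x \<bullet> z" for y
  proof -
    obtain g where "\<And>v. v \<in> UNIV \<Longrightarrow> g \<bullet> v = B v \<bullet> y"
    proof (rule riesz_representation_subspace[of UNIV "\<lambda>v. B v \<bullet> y" "c * norm y"])
      fix x
      have "\<bar>B x \<bullet> y\<bar> \<le> norm (B x) * norm y" by (rule Cauchy_Schwarz_ineq2)
      also have "\<dots> \<le> norm x * c * norm y" using c by (intro mult_right_mono) auto
      finally show "\<bar>B x \<bullet> y\<bar> \<le> c * norm y * norm x" by (simp add: algebra_simps)
    qed (auto simp: linear_add[OF B.linear] linear_scale[OF B.linear] inner_simps)
    then show ?thesis by (metis UNIV_I inner_commute)
  qed
  then have "\<exists>f'. \<forall>x y. B x \<bullet> y = x \<bullet> f' y" by metis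
  then have adj: "\<forall>x y. B x \<bullet> y = x \<bullet> adjoint B y" unfolding adjoint_def by (rule someI_ex)
  then show "B x \<bullet> y = x \<bullet> adjoint B y" by blast
  show "bounded_linear (adjoint B)"
  proof
    fix y z r
    have "x \<bullet> adjoint B (y + z) = x \<bullet> (adjoint B y + adjoint B z)" for x
      using adj by (metis inner_add_right)
    then show "adjoint B (y + z) = adjoint B y + adjoint B z" by (metis vector_eq_ldot)
    have "x \<bullet> adjoint B (r *\<^sub>R y) = x \<bullet> (r *\<^sub>R adjoint B y)" for x
      using adj by (metis inner_scaleR_right)
    then show "adjoint B (r *\<^sub>R y) = r *\<^sub>R adjoint B y" by (metis vector_eq_ldot)
  next
    show "\<exists>K. \<forall>y. norm (adjoint B y) \<le> norm y * K"
    proof (intro exI[of _ c] allI)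
      fix y
      have "(norm (adjoint B y))\<^sup>2 = B (adjoint B y) \<bullet> y" using adj by (simp add: power2_norm_eq_inner)
      also have "\<dots> \<le> norm (B (adjoint B y)) * norm y" by (rule norm_cauchy_schwarz)
      also have "\<dots> \<le> norm (adjoint B y) * c * norm y" using c by (intro mult_right_mono) auto
      finally have "norm (adjoint B y) * norm (adjoint B y) \<le> norm (adjoint B y) * (norm y * c)"
        by (simp add: power2_eq_square algebra_simps)
      then show "norm (adjoint B y) \<le> norm y * c"
        using \<open>c > 0\<close> by (cases "norm (adjoint B y) = 0") (auto simp: mult_le_cancel_left)
    qed
  qed
qed

text \<open>The Hellinger--Toeplitz theorem. Linearity is immediate from symmetry. The sets on which
  \<open>norm (T y) \<le> n\<close> are closed and cover the space, so that by the Baire category theorem one of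
  them contains a ball.\<close>

lemma symmetric_imp_bounded_linear:
  fixes T :: "'a::{real_inner, banach} \<Rightarrow> 'a"
  assumes sym: "\<And>x y. T x \<bullet> y = x \<bullet> T y"
  shows "bounded_linear T"
proof -
  have add: "T (x + y) = T x + T y" for x y
  proof -
    have "T (x + y) \<bullet> z = (T x + T y) \<bullet> z" for z by (simp add: sym inner_simps)
    then show ?thesis by (metis vector_eq_rdot)
  qed
  have scale: "T (r *\<^sub>R x) = r *\<^sub>R T x" for r x
  proof -
    have "T (r *\<^sub>R x) \<bullet> z = (r *\<^sub>R T x) \<bullet> z" for z by (simp add: sym)
    then show ?thesis by (metis vector_eq_rdot)
  qed
  \<comment> \<open>\<open>norm \<circ> T\<close> is a supremum of the continuous functions \<open>y \<mapsto> \<bar>T x \<bullet> y\<bar>\<close>, so that its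
    sublevel sets are closed.\<close>
  define F where "F n = {y. norm (T y) \<le> real n}" for n
  have F_eq: "F n = (\<Inter>x\<in>{x. norm x \<le> 1}. {y. \<bar>T x \<bullet> y\<bar> \<le> real n})" for n
  proof (intro equalityI subsetI)
    fix y assume "y \<in> F n"
    then have y: "norm (T y) \<le> real n" by (simp add: F_def)
    have "\<bar>T x \<bullet> y\<bar> \<le> real n" if "norm x \<le> 1" for x
    proof -
      have "\<bar>x \<bullet> T y\<bar> \<le> norm x * norm (T y)" by (rule Cauchy_Schwarz_ineq2)
      also have "\<dots> \<le> 1 * real n" using that y by (intro mult_mono) auto
      finally show ?thesis by (simp add: sym)
    qed
    then show "y \<in> (\<Inter>x\<in>{x. norm x \<le> 1}. {y. \<bar>T x \<bullet> y\<bar> \<le> real n})" by auto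
  next
    fix y assume *: "y \<in> (\<Inter>x\<in>{x. norm x \<le> 1}. {y. \<bar>T x \<bullet> y\<bar> \<le> real n})"
    have "norm (sgn (T y)) \<le> 1" by (simp add: norm_sgn)
    then have "\<bar>sgn (T y) \<bullet> T y\<bar> \<le> real n" using * by (auto simp: sym)
    moreover have "sgn (T y) \<bullet> T y = norm (T y)"
      by (cases "T y = 0") (simp_all add: sgn_div_norm dot_square_norm power2_eq_square)
    ultimately show "y \<in> F n" by (simp add: F_def)
  qed
  have "closed (F n)" for n
    unfolding F_eq by (intro closed_INT ballI closed_Collect_le continuous_intros)
  have "\<exists>n. interior (F n) \<noteq> {}"
  proof (rule ccontr)
    assume "\<not> ?thesis"
    then have "euclidean interior_of \<Union>(range F) = {}"
      using \<open>\<And>n. closed (F n)\<close>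
      by (intro Baire_category_alt) (auto simp: completely_metrizable_space_euclidean)
    moreover have "\<Union>(range F) = UNIV"
      using real_arch_simple by (auto simp: F_def)
    ultimately show False by simp
  qed
  then obtain n y0 e where "e > 0" and e: "ball y0 e \<subseteq> F n"
    by (metis all_not_in_conv mem_interior)
  have "norm (T x) \<le> norm x * (4 * real n / e)" for x
  proof (cases "x = 0")
    case True
    then show ?thesis using scale[of 0 0] by simp
  next
    case False
    define r where "r = e / (2 * norm x)"
    have "r > 0" using False \<open>e > 0\<close> by (simp add: r_def)
    have "norm (r *\<^sub>R x) < e" using False \<open>e > 0\<close> by (simp add: r_def)
    then have "y0 + r *\<^sub>R x \<in> F n" "y0 \<in> F n" using e \<open>e > 0\<close> by (auto simp: dist_norm)
    then have "norm (T (y0 + r *\<^sub>R x)) \<le> real n" "norm (T y0) \<le> real n" by (auto simp: F_def)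
    moreover have diff: "r *\<^sub>R T x = T (y0 + r *\<^sub>R x) - T y0" by (simp add: add scale)
    ultimately have "norm (r *\<^sub>R T x) \<le> 2 * real n"
      unfolding diff using norm_triangle_ineq4[of "T (y0 + r *\<^sub>R x)" "T y0"] by linarith
    then show ?thesis using \<open>r > 0\<close> False \<open>e > 0\<close> by (simp add: r_def field_simps)
  qed
  with add scale show ?thesis by (rule bounded_linear_intro)
qed

lemma is_sqrt_operatorD:
  assumes "is_sqrt_operator DV rA DA A"
  shows "subspace DV" "linear_operator DV rA" "closure DV = UNIV"
    "\<And>x y. x \<in> DV \<Longrightarrow> y \<in> DV \<Longrightarrow> rA x \<bullet> y = x \<bullet> rA y"
    "\<And>y z. (\<And>x. x \<in> DV \<Longrightarrow> rA x \<bullet> y = x \<bullet> z) \<Longrightarrow> y \<in> DV \<and> z = rA y"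
    "\<And>x. x \<in> DV \<Longrightarrow> rA x = 0 \<Longrightarrow> x = 0"
    "\<And>x y. x \<in> DV \<Longrightarrow> y \<in> DV \<Longrightarrow> rA (x + y) = rA x + rA y"
    "\<And>x y. x \<in> DV \<Longrightarrow> y \<in> DV \<Longrightarrow> rA (x - y) = rA x - rA y"
    "\<And>r x. x \<in> DV \<Longrightarrow> rA (r *\<^sub>R x) = r *\<^sub>R rA x"
proof -
  have sa: "selfadjoint_operator DV rA" and pos: "\<And>x. x \<in> DV \<Longrightarrow> x \<noteq> 0 \<Longrightarrow> 0 < rA x \<bullet> x"
    using assms by (auto simp: is_sqrt_operator_def positive_selfadjoint_def)
  then show lin: "linear_operator DV rA" and "closure DV = UNIV"
    by (auto simp: selfadjoint_operator_def)
  then show sub: "subspace DV" by (auto simp: linear_operator_def)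
  have "(\<forall>x\<in>DV. rA x \<bullet> y = x \<bullet> z) \<longleftrightarrow> y \<in> DV \<and> z = rA y" for y z
    using sa by (auto simp: selfadjoint_operator_def)
  then show "\<And>x y. x \<in> DV \<Longrightarrow> y \<in> DV \<Longrightarrow> rA x \<bullet> y = x \<bullet> rA y"
    "\<And>y z. (\<And>x. x \<in> DV \<Longrightarrow> rA x \<bullet> y = x \<bullet> z) \<Longrightarrow> y \<in> DV \<and> z = rA y" by blast+
  show "\<And>x. x \<in> DV \<Longrightarrow> rA x = 0 \<Longrightarrow> x = 0" using pos by force
  show add: "\<And>x y. x \<in> DV \<Longrightarrow> y \<in> DV \<Longrightarrow> rA (x + y) = rA x + rA y"
    and scale: "\<And>r x. x \<in> DV \<Longrightarrow> rA (r *\<^sub>R x) = r *\<^sub>R rA x"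
    using lin by (auto simp: linear_operator_def)
  show "rA (x - y) = rA x - rA y" if "x \<in> DV" "y \<in> DV" for x y
    using add[of x "(- 1) *\<^sub>R y"] scale[of y "- 1"] that subspace_scale[OF sub, of y "- 1"] by simp
qed

text \<open>Completeness of the energy space says that the range of \<open>rA\<close> is closed. A vector orthogonal to
  the range lies in the kernel of \<open>rA\<close>, since \<open>rA\<close> is self-adjoint, and the kernel is trivial. Hence
  \<open>rA\<close> is onto, and its inverse is symmetric and everywhere defined, thus bounded. In particular
  the energy norm dominates the norm of the ambient space.\<close>

lemma sqrt_operator_inverse:
  fixes DV :: "'a::{real_inner, banach} set"
  assumes sq: "is_sqrt_operator DV rA DA A"
    and complete: "complete (energy_emb rA ` energy_space DV)"
  obtains T where "bounded_linear T" "\<And>x. T x \<in> DV" "\<And>x. rA (T x) = x" "\<And>u. u \<in> DV \<Longrightarrow> T (rA u) = u"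
proof -
  note rA = is_sqrt_operatorD[OF sq]
  let ?Y = "rA ` DV"
  have image: "energy_emb rA ` energy_space DV = ?Y \<times> UNIV"
    by (force simp: energy_emb_def energy_space_def image_iff)
  have "closed (?Y \<times> (UNIV :: 'a set))"
    using complete unfolding image by (rule complete_imp_closed)
  then have "closed ((\<lambda>x. (x, 0 :: 'a)) -` (?Y \<times> UNIV))"
    by (intro continuous_closed_vimage) (auto intro!: continuous_intros)
  moreover have "(\<lambda>x. (x, 0 :: 'a)) -` (?Y \<times> UNIV) = ?Y" by auto
  ultimately have Y_closed: "closed ?Y" by simp
  have Y_sub: "subspace ?Y"
  proof (rule subspaceI)
    show "0 \<in> ?Y" using rA(9)[of 0 0] subspace_0[OF rA(1)] by force
    show "x + y \<in> ?Y" if "x \<in> ?Y" "y \<in> ?Y" for x y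
      using that subspace_add[OF rA(1)] by (auto simp: rA(7)[symmetric])
    show "c *\<^sub>R x \<in> ?Y" if "x \<in> ?Y" for c x
      using that subspace_scale[OF rA(1)] by (auto simp: rA(9)[symmetric])
  qed
  have "y \<in> ?Y" for y
  proof -
    obtain g where g: "g \<in> closure ?Y" "\<And>v. v \<in> ?Y \<Longrightarrow> g \<bullet> v = y \<bullet> v"
      by (rule riesz_representation_subspace[OF Y_sub, of "\<lambda>v. y \<bullet> v" "norm y"])
        (auto simp: inner_simps Cauchy_Schwarz_ineq2)
    have "rA x \<bullet> (y - g) = x \<bullet> 0" if "x \<in> DV" for x
      using g(2)[of "rA x"] that by (simp add: inner_simps inner_commute)
    from rA(5)[OF this] have "y - g \<in> DV" "rA (y - g) = 0" by auto
    then have "y = g" using rA(6)[of "y - g"] by simp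
    then show ?thesis using g(1) Y_closed by simp
  qed
  then have "\<forall>y. \<exists>u. u \<in> DV \<and> rA u = y" by (metis imageE)
  then obtain T where T: "\<And>y. T y \<in> DV" "\<And>y. rA (T y) = y" by metis
  have left_inverse: "T (rA u) = u" if "u \<in> DV" for u
    using rA(6)[of "T (rA u) - u"] rA(8)[of "T (rA u)" u] T that subspace_diff[OF rA(1)] by simp
  have "T x \<bullet> y = x \<bullet> T y" for x y
    using rA(4)[of "T x" "T y"] T by simp
  then have "bounded_linear T" by (rule symmetric_imp_bounded_linear)
  then show ?thesis using that T left_inverse by blast
qed

text \<open>The Riesz representative exists because the derivative is bounded in the ambient norm, and it is
  unique because \<open>D\<close> is dense.\<close>

lemma gradient_on_inner:
  fixes D :: "'a::{real_inner, banach} set"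
  assumes "bounded_gateaux D \<psi>" "closure D = UNIV" "u \<in> D" "v \<in> D"
  shows "gradient_on D \<psi> u \<bullet> v = gateaux_deriv \<psi> u v"
proof -
  have "gateaux_differentiable D \<psi> u"
    using assms by (auto simp: bounded_gateaux_def)
  then have lin: "linear_operator D (gateaux_deriv \<psi> u)" by (simp add: gateaux_differentiable_def)
  obtain c where c: "\<And>v. v \<in> D \<Longrightarrow> \<bar>gateaux_deriv \<psi> u v\<bar> \<le> c * norm v"
    using assms(1,3) unfolding bounded_gateaux_def by blast
  obtain g where g: "\<And>v. v \<in> D \<Longrightarrow> g \<bullet> v = gateaux_deriv \<psi> u v"
    by (rule riesz_representation_subspace[of D "gateaux_deriv \<psi> u" c])
      (use lin c in \<open>auto simp: linear_operator_def\<close>)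
  have "g' = g" if g': "\<forall>v\<in>D. g' \<bullet> v = gateaux_deriv \<psi> u v" for g'
  proof -
    have "(g' - g) \<bullet> x = 0" if "x \<in> closure D" for x
    proof (rule continuous_constant_on_closure[OF _ _ that])
      show "continuous_on (closure D) (\<lambda>x. (g' - g) \<bullet> x)" by (intro continuous_intros)
    qed (use g g' in \<open>auto simp: inner_simps\<close>)
    then have "(g' - g) \<bullet> (g' - g) = 0" using assms(2) by blast
    then show ?thesis by simp
  qed
  then have "gradient_on D \<psi> u = g"
    unfolding gradient_on_def using g by (intro the_equality) simp_all
  then show ?thesis using g assms(4) by simp
qed

text \<open>The mean value theorem along the segment from \<open>0\<close> to \<open>u\<close> gives \<open>\<psi> u = D\<psi>(s u) u\<close> for some \<open>s\<close> in
  \<open>(0, 1)\<close>, and the growth bound is applied at \<open>s u\<close>. It is the multiple by \<open>s\<close> that the bound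
  controls; its right-hand side carries \<open>s\<^sup>2\<close>, so that this factor can be divided out.\<close>

lemma potential_bound:
  fixes DV :: "'a::{real_inner, banach} set"
  assumes sq: "is_sqrt_operator DV rA DA A"
    and \<psi>: "bounded_gateaux DV \<psi>" "\<psi> 0 = 0"
    and h: "strict_mono_on {0..} h"
    and grad: "\<And>u. u \<in> DV \<Longrightarrow> \<bar>gradient_on DV \<psi> u \<bullet> u\<bar> \<le> h (norm (rA u)) * (norm (rA u))\<^sup>2"
    and u: "u \<in> DV"
  shows "\<bar>\<psi> u\<bar> \<le> \<bar>h (norm (rA u))\<bar> * (norm (rA u))\<^sup>2"
proof -
  note rA = is_sqrt_operatorD[OF sq]
  have su: "s *\<^sub>R u \<in> DV" for s using rA(1) u by (rule subspace_scale)
  have "((\<lambda>s. \<psi> (s *\<^sub>R u)) has_real_derivative gradient_on DV \<psi> (s *\<^sub>R u) \<bullet> u) (at s)" for s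
  proof -
    have "((\<lambda>k. (\<psi> (s *\<^sub>R u + k *\<^sub>R u) - \<psi> (s *\<^sub>R u)) / k) \<longlongrightarrow> gateaux_deriv \<psi> (s *\<^sub>R u) u) (at 0)"
      using \<psi>(1) su u by (auto simp: bounded_gateaux_def gateaux_differentiable_def)
    then show ?thesis
      using gradient_on_inner[OF \<psi>(1) rA(3) su u] by (simp add: DERIV_def scaleR_add_left)
  qed
  then obtain s where s: "0 < s" "s < 1"
      and mvt: "\<psi> (1 *\<^sub>R u) - \<psi> (0 *\<^sub>R u) = (1 - 0) * (gradient_on DV \<psi> (s *\<^sub>R u) \<bullet> u)"
    using MVT2[of 0 1 "\<lambda>s. \<psi> (s *\<^sub>R u)" "\<lambda>s. gradient_on DV \<psi> (s *\<^sub>R u) \<bullet> u"] by auto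
  let ?r = "norm (rA u)"
  have "s * \<bar>\<psi> u\<bar> = \<bar>gradient_on DV \<psi> (s *\<^sub>R u) \<bullet> (s *\<^sub>R u)\<bar>"
    using mvt s \<psi>(2) by (simp add: abs_mult)
  also have "\<dots> \<le> h (s * ?r) * (s * ?r)\<^sup>2"
    using grad[OF su, of s] s rA(9)[OF u] by simp
  also have "\<dots> \<le> \<bar>h ?r\<bar> * (s * ?r)\<^sup>2"
  proof -
    have "h (s * ?r) \<le> h ?r"
      using s by (intro strict_mono_on_leD[OF h]) (auto simp: mult_left_le_one_le)
    then show ?thesis by (intro mult_right_mono) auto
  qed
  also have "\<dots> = s * (s * (\<bar>h ?r\<bar> * ?r\<^sup>2))" by (simp add: power2_eq_square)
  also have "\<dots> \<le> s * (1 * (\<bar>h ?r\<bar> * ?r\<^sup>2))"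
    using s by (intro mult_left_mono mult_right_mono) auto
  finally show ?thesis using s by simp
qed

section \<open>Strongly continuous semigroups\<close>

text \<open>The exponential bound with a fixed rate is part of the locale because all constants below are
  expressed through \<open>M\<close> and \<open>\<omega>\<close>.\<close>

locale stable_semigroup =
  fixes S :: "real \<Rightarrow> 'z::banach \<Rightarrow> 'z" and M \<omega> :: real
  assumes bounded_linear_S: "0 \<le> t \<Longrightarrow> bounded_linear (S t)"
    and S_zero: "S 0 x = x"
    and S_add: "0 \<le> s \<Longrightarrow> 0 \<le> t \<Longrightarrow> S (s + t) x = S s (S t x)"
    and S_bound: "0 \<le> t \<Longrightarrow> norm (S t x) \<le> M * exp (- \<omega> * t) * norm x"
    and S_right_continuous: "((\<lambda>t. S t x) \<longlongrightarrow> x) (at_right 0)"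
    and M_pos: "0 < M" and \<omega>_pos: "0 < \<omega>"
begin

lemma S_diff: "0 \<le> t \<Longrightarrow> S t (x - y) = S t x - S t y"
  by (rule linear_diff[OF bounded_linear.linear[OF bounded_linear_S]])

lemma S_bound_const: "0 \<le> t \<Longrightarrow> norm (S t x) \<le> M * norm x"
proof -
  assume "0 \<le> t"
  then have "M * exp (- \<omega> * t) * norm x \<le> M * 1 * norm x"
    using M_pos \<omega>_pos by (intro mult_right_mono mult_left_mono) auto
  then show ?thesis using S_bound[OF \<open>0 \<le> t\<close>, of x] by simp
qed

lemma orbit_diff_bound:
  assumes "0 \<le> s" "0 \<le> t"
  shows "norm (S t x - S s x) \<le> M * norm (S \<bar>t - s\<bar> x - x)"
proof -
  have *: "norm (S v x - S u x) \<le> M * norm (S (v - u) x - x)" if "0 \<le> u" "u \<le> v" for u v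
  proof -
    have "S v x - S u x = S u (S (v - u) x - x)"
      using S_add[of u "v - u" x] that by (simp add: S_diff)
    then show ?thesis using S_bound_const[of u] that by simp
  qed
  show ?thesis
    using *[of s t] *[of t s] assms by (cases "s \<le> t") (auto simp: norm_minus_commute)
qed

lemma S_near_zero:
  assumes "e > 0"
  obtains d where "d > 0" "\<And>h. 0 \<le> h \<Longrightarrow> h < d \<Longrightarrow> norm (S h x - x) < e"
proof -
  have "eventually (\<lambda>h. norm (S h x - x) < e) (at_right 0)"
    using S_right_continuous[of x] assms by (auto simp: tendsto_iff dist_norm)
  then obtain d where "d > 0" "\<And>h. 0 < h \<Longrightarrow> h < d \<Longrightarrow> norm (S h x - x) < e"
    unfolding eventually_at_right_field by auto
  then have "norm (S h x - x) < e" if "0 \<le> h" "h < d" for h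
    using that assms by (cases "h = 0") (auto simp: S_zero)
  then show ?thesis using that \<open>d > 0\<close> by blast
qed

text \<open>Strong continuity at \<open>0\<close> and the uniform bound \<open>M\<close> on the norms give joint continuity in time
  and state.\<close>

lemma continuous_on_S_pair: "continuous_on ({0..} \<times> UNIV) (\<lambda>p. S (fst p) (snd p))"
  unfolding continuous_on_iff
proof (intro ballI allI impI)
  fix p0 :: "real \<times> 'z" and e :: real
  assume p0: "p0 \<in> {0..} \<times> UNIV" and "e > 0"
  obtain t0 x0 where [simp]: "p0 = (t0, x0)" by force
  have "e / (2 * M) > 0" using \<open>e > 0\<close> M_pos by simp
  then obtain d where d: "d > 0" "\<And>h. 0 \<le> h \<Longrightarrow> h < d \<Longrightarrow> norm (S h x0 - x0) < e / (2 * M)"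
    using S_near_zero by blast
  show "\<exists>d>0. \<forall>p\<in>{0..} \<times> UNIV. dist p p0 < d \<longrightarrow> dist (S (fst p) (snd p)) (S (fst p0) (snd p0)) < e"
  proof (intro exI[of _ "min d (e / (2 * M))"] conjI ballI impI)
    show "0 < min d (e / (2 * M))" using d \<open>e / (2 * M) > 0\<close> by simp
    fix p :: "real \<times> 'z" assume p: "p \<in> {0..} \<times> UNIV" "dist p p0 < min d (e / (2 * M))"
    obtain t x where [simp]: "p = (t, x)" by force
    have "\<bar>t - t0\<bar> < d" "norm (x - x0) < e / (2 * M)"
      using p(2) dist_fst_le[of p p0] dist_snd_le[of p p0] by (auto simp: dist_norm)
    have "norm (S t x - S t0 x0) \<le> norm (S t (x - x0)) + norm (S t x0 - S t0 x0)"
      using p(1) norm_triangle_ineq[of "S t (x - x0)" "S t x0 - S t0 x0"] by (simp add: S_diff)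
    also have "\<dots> \<le> M * norm (x - x0) + M * norm (S \<bar>t - t0\<bar> x0 - x0)"
      using p(1) p0 by (intro add_mono S_bound_const orbit_diff_bound) auto
    also have "\<dots> < M * (e / (2 * M)) + M * (e / (2 * M))"
      using d(2)[of "\<bar>t - t0\<bar>"] \<open>\<bar>t - t0\<bar> < d\<close> \<open>norm (x - x0) < e / (2 * M)\<close> M_pos
      by (intro add_strict_mono mult_strict_left_mono) auto
    also have "\<dots> = e" using M_pos by simp
    finally show "dist (S (fst p) (snd p)) (S (fst p0) (snd p0)) < e" by (simp add: dist_norm)
  qed
qed

lemma continuous_on_S:
  assumes "continuous_on A f" "continuous_on A g" "\<And>s. s \<in> A \<Longrightarrow> 0 \<le> f s"
  shows "continuous_on A (\<lambda>s. S (f s) (g s))"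
proof -
  have "continuous_on A ((\<lambda>p. S (fst p) (snd p)) \<circ> (\<lambda>s. (f s, g s)))"
    using assms by (intro continuous_on_compose continuous_on_subset[OF continuous_on_S_pair]
        continuous_on_Pair) auto
  then show ?thesis by (simp add: o_def)
qed

lemma convolution_integrable:
  assumes "a absolutely_integrable_on {0..t}" "continuous_on {0..t} h"
  shows "(\<lambda>s. a s *\<^sub>R S (t - s) (h s)) integrable_on {0..t}"
  using assms by (intro integrable_scaleR_continuous continuous_on_S continuous_intros) auto

text \<open>The kernel \<open>S (t - s) (h s)\<close>, continued by \<open>h s\<close> for \<open>s > t\<close>, is jointly continuous on a compact
  square, hence uniformly continuous; integrated against \<open>\<bar>a\<bar>\<close> over the whole interval it varies
  continuously with \<open>t\<close>. The part of the integral over \<open>{t..T}\<close> is subtracted afterwards.\<close>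

lemma continuous_on_convolution:
  assumes a: "a absolutely_integrable_on {0..T}" and h: "continuous_on {0..T} h"
  shows "continuous_on {0..T} (\<lambda>t. integral {0..t} (\<lambda>s. a s *\<^sub>R S (t - s) (h s)))"
proof -
  define H where "H t s = S (max 0 (t - s)) (h s)" for t s
  have abs_a: "(\<lambda>s. \<bar>a s\<bar>) integrable_on {0..T}"
    using a by (auto simp: absolutely_integrable_on_def)
  have H_cont: "continuous_on ({0..T} \<times> {0..T}) (\<lambda>p. H (fst p) (snd p))"
    unfolding H_def
    by (intro continuous_on_S continuous_intros continuous_on_compose2[OF h]) auto
  then have H_unif: "uniformly_continuous_on ({0..T} \<times> {0..T}) (\<lambda>p. H (fst p) (snd p))"
    by (intro compact_uniformly_continuous compact_Times) auto
  have aH: "(\<lambda>s. a s *\<^sub>R H t s) integrable_on {0..T}" for t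
    unfolding H_def using a
    by (rule integrable_scaleR_continuous) (intro continuous_on_S continuous_intros h; simp)
  define F where "F t = integral {0..T} (\<lambda>s. a s *\<^sub>R H t s)" for t
  have F_cont: "continuous_on {0..T} F"
    unfolding continuous_on_iff
  proof (intro ballI allI impI)
    fix t e :: real assume t: "t \<in> {0..T}" and "e > 0"
    define J where "J = integral {0..T} (\<lambda>s. \<bar>a s\<bar>)"
    have "J \<ge> 0" unfolding J_def using abs_a by (intro integral_nonneg) auto
    define \<epsilon> where "\<epsilon> = e / (J + 1)"
    have "\<epsilon> > 0" using \<open>e > 0\<close> \<open>J \<ge> 0\<close> by (simp add: \<epsilon>_def)
    then obtain d where d: "d > 0" "\<And>p q. p \<in> {0..T} \<times> {0..T} \<Longrightarrow> q \<in> {0..T} \<times> {0..T} \<Longrightarrow>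
        dist q p < d \<Longrightarrow> dist (H (fst q) (snd q)) (H (fst p) (snd p)) < \<epsilon>"
      using H_unif unfolding uniformly_continuous_on_def by metis
    show "\<exists>d>0. \<forall>t'\<in>{0..T}. dist t' t < d \<longrightarrow> dist (F t') (F t) < e"
    proof (intro exI[of _ d] conjI d(1) ballI impI)
      fix t' assume t': "t' \<in> {0..T}" "dist t' t < d"
      have "F t' - F t = integral {0..T} (\<lambda>s. a s *\<^sub>R H t' s - a s *\<^sub>R H t s)"
        unfolding F_def by (intro integral_diff[symmetric] aH)
      also have "norm \<dots> \<le> integral {0..T} (\<lambda>s. \<bar>a s\<bar> * \<epsilon>)"
      proof (rule integral_norm_bound_integral)
        fix s assume s: "s \<in> {0..T}"
        have "norm (H t' s - H t s) \<le> \<epsilon>"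
          using d(2)[of "(t, s)" "(t', s)"] t t' s by (simp add: dist_Pair_Pair dist_norm)
        then show "norm (a s *\<^sub>R H t' s - a s *\<^sub>R H t s) \<le> \<bar>a s\<bar> * \<epsilon>"
          by (simp add: scaleR_diff_right[symmetric] mult_left_mono)
      qed (use abs_a aH in \<open>auto intro!: integrable_diff integrable_on_mult_left\<close>)
      also have "\<dots> = J * \<epsilon>" by (simp add: J_def)
      also have "\<dots> < e" using \<open>J \<ge> 0\<close> \<open>e > 0\<close> by (simp add: \<epsilon>_def field_simps)
      finally show "dist (F t') (F t) < e" by (simp add: dist_norm)
    qed
  qed
  have ah: "(\<lambda>s. a s *\<^sub>R h s) integrable_on {0..T}"
    using a h by (rule integrable_scaleR_continuous)
  have "F t - integral {t..T} (\<lambda>s. a s *\<^sub>R h s) = integral {0..t} (\<lambda>s. a s *\<^sub>R S (t - s) (h s))"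
    if t: "t \<in> {0..T}" for t
  proof -
    have "F t = integral {0..t} (\<lambda>s. a s *\<^sub>R H t s) + integral {t..T} (\<lambda>s. a s *\<^sub>R H t s)"
      unfolding F_def using t by (intro Henstock_Kurzweil_Integration.integral_combine[symmetric] aH) auto
    also have "integral {t..T} (\<lambda>s. a s *\<^sub>R H t s) = integral {t..T} (\<lambda>s. a s *\<^sub>R h s)"
      by (rule integral_cong) (simp add: H_def S_zero)
    also have "integral {0..t} (\<lambda>s. a s *\<^sub>R H t s) = integral {0..t} (\<lambda>s. a s *\<^sub>R S (t - s) (h s))"
      by (rule integral_cong) (simp add: H_def)
    finally show ?thesis by simp
  qed
  moreover have "continuous_on {0..T} (\<lambda>t. F t - integral {t..T} (\<lambda>s. a s *\<^sub>R h s))"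
    by (intro continuous_intros F_cont indefinite_integral_continuous_1' ah)
  ultimately show ?thesis by (rule continuous_on_eq[rotated])
qed

text \<open>The semigroup law: a mild solution is also a mild solution when it is restarted at time \<open>r\<close>.\<close>

lemma mild_solution_restart:
  assumes mild: "\<And>t. 0 \<le> t \<Longrightarrow> ((\<lambda>s. S (t - s) (g s)) has_integral (u t - S t (u 0))) {0..t}"
    and "0 \<le> r" "r \<le> t"
  shows "((\<lambda>s. S (t - s) (g s)) has_integral (u t - S (t - r) (u r))) {r..t}"
proof -
  have "((S (t - r) \<circ> (\<lambda>s. S (r - s) (g s))) has_integral S (t - r) (u r - S r (u 0))) {0..r}"
    using assms by (intro has_integral_linear bounded_linear_S) auto
  moreover have "S (t - r) (S (r - s) (g s)) = S (t - s) (g s)" if "s \<in> {0..r}" for s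
    using S_add[of "t - r" "r - s" "g s"] that assms(2,3) by simp
  moreover have "S (t - r) (S r (u 0)) = S t (u 0)"
    using S_add[of "t - r" r "u 0"] assms(2,3) by simp
  ultimately have left: "((\<lambda>s. S (t - s) (g s)) has_integral (S (t - r) (u r) - S t (u 0))) {0..r}"
    using assms by (subst has_integral_cong[where g = "S (t - r) \<circ> (\<lambda>s. S (r - s) (g s))"])
      (auto simp: S_diff)
  have all: "((\<lambda>s. S (t - s) (g s)) has_integral (u t - S t (u 0))) {0..t}"
    using mild assms by auto
  then have right: "(\<lambda>s. S (t - s) (g s)) integrable_on {r..t}"
    using assms by (intro integrable_subinterval_real[OF has_integral_integrable[OF all]]) auto
  have "((\<lambda>s. S (t - s) (g s)) has_integral (S (t - r) (u r) - S t (u 0)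
      + integral {r..t} (\<lambda>s. S (t - s) (g s)))) {0..t}"
    using assms by (intro has_integral_combine[OF _ _ left integrable_integral[OF right]]) auto
  then have "S (t - r) (u r) - S t (u 0) + integral {r..t} (\<lambda>s. S (t - s) (g s)) = u t - S t (u 0)"
    using all has_integral_unique by blast
  then have "integral {r..t} (\<lambda>s. S (t - s) (g s)) = u t - S (t - r) (u r)"
    by (simp add: algebra_simps)
  with right show ?thesis by (metis integrable_integral)
qed

text \<open>The time integral \<open>V\<close> of any orbit lies in the domain of the generator, which maps it to the
  increment of the orbit. This gives access to the generator for arbitrary initial values, not
  only for those in its domain.\<close>

lemma orbit_integral_generator:
  fixes x :: 'z
  assumes "0 \<le> t"
  defines "V \<equiv> integral {0..t} (\<lambda>s. S s x)"
  shows "((\<lambda>h. (1 / h) *\<^sub>R (S h V - V)) \<longlongrightarrow> S t x - x) (at_right 0)"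
proof -
  have cont: "continuous_on A (\<lambda>s. S s x)" if "A \<subseteq> {0..}" for A
    using that by (intro continuous_on_S continuous_intros) auto
  have average: "((\<lambda>h. (1 / h) *\<^sub>R integral {r..r + h} (\<lambda>s. S s x)) \<longlongrightarrow> S r x) (at_right 0)"
    if "0 \<le> r" for r
  proof (rule tendstoI)
    fix e :: real assume "e > 0"
    then have "e / (2 * M) > 0" using M_pos by simp
    then obtain d where d: "d > 0" "\<And>h. 0 \<le> h \<Longrightarrow> h < d \<Longrightarrow> norm (S h x - x) < e / (2 * M)"
      using S_near_zero by blast
    show "eventually (\<lambda>h. dist ((1 / h) *\<^sub>R integral {r..r + h} (\<lambda>s. S s x)) (S r x) < e) (at_right 0)"
      unfolding eventually_at_right_field
    proof (intro exI[of _ d] conjI d(1) allI impI)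
      fix h assume h: "0 < h" "h < d"
      have int: "(\<lambda>s. S s x) integrable_on {r..r + h}"
        using that by (intro integrable_continuous_real cont) auto
      have "norm (integral {r..r + h} (\<lambda>s. S s x - S r x)) \<le> (e / 2) * (r + h - r)"
      proof (rule integral_bound)
        show "continuous_on {r..r + h} (\<lambda>s. S s x - S r x)"
          using that by (intro continuous_intros cont) auto
        fix s assume s: "s \<in> {r..r + h}"
        have "norm (S s x - S r x) \<le> M * norm (S \<bar>s - r\<bar> x - x)"
          using s that by (intro orbit_diff_bound) auto
        also have "\<dots> \<le> M * (e / (2 * M))"
          using d(2)[of "\<bar>s - r\<bar>"] s h M_pos by (intro mult_left_mono less_imp_le) auto
        finally show "norm (S s x - S r x) \<le> e / 2" using M_pos by simp
      qed (use h in simp)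
      moreover have "integral {r..r + h} (\<lambda>s. S s x - S r x) = integral {r..r + h} (\<lambda>s. S s x) - h *\<^sub>R S r x"
        using int h by (subst integral_diff) auto
      ultimately have "norm (integral {r..r + h} (\<lambda>s. S s x) - h *\<^sub>R S r x) \<le> e / 2 * h" by simp
      then have "norm ((1 / h) *\<^sub>R (integral {r..r + h} (\<lambda>s. S s x) - h *\<^sub>R S r x)) \<le> e / 2"
        using h by (simp only: norm_scaleR) (simp add: field_simps)
      then show "dist ((1 / h) *\<^sub>R integral {r..r + h} (\<lambda>s. S s x)) (S r x) < e"
        using h \<open>e > 0\<close> by (simp add: dist_norm scaleR_diff_right)
    qed
  qed
  have "S h V - V = integral {t..t + h} (\<lambda>s. S s x) - integral {0..0 + h} (\<lambda>s. S s x)" if "h > 0" for h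
  proof -
    have int: "(\<lambda>s. S s x) integrable_on {0..b}" for b
      by (intro integrable_continuous_real cont) auto
    have "((S h \<circ> (\<lambda>s. S s x)) has_integral S h V) {0..t}"
      unfolding V_def using that by (intro has_integral_linear bounded_linear_S integrable_integral int) auto
    then have "((\<lambda>s. S (s + h) x) has_integral S h V) {h - h..(t + h) - h}"
      using that S_add[of h _ x] by (subst has_integral_cong[where g = "S h \<circ> (\<lambda>s. S s x)"])
        (auto simp: add.commute)
    then have "((\<lambda>s. S s x) has_integral S h V) {h..t + h}"
      by (subst has_integral_shift_real_ivl_iff[where c = h])
    then have "integral {0..t + h} (\<lambda>s. S s x) = integral {0..h} (\<lambda>s. S s x) + S h V"
      using that assms(1) Henstock_Kurzweil_Integration.integral_combine[of 0 h "t + h" "\<lambda>s. S s x", OF _ _ int]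
      by (simp add: integral_unique)
    moreover have "integral {0..t + h} (\<lambda>s. S s x) = V + integral {t..t + h} (\<lambda>s. S s x)"
      unfolding V_def using that assms(1) by (intro Henstock_Kurzweil_Integration.integral_combine[symmetric] int) auto
    ultimately show ?thesis by (simp add: algebra_simps)
  qed
  then have "eventually (\<lambda>h. (1 / h) *\<^sub>R integral {t..t + h} (\<lambda>s. S s x)
      - (1 / h) *\<^sub>R integral {0..0 + h} (\<lambda>s. S s x) = (1 / h) *\<^sub>R (S h V - V)) (at_right 0)"
    unfolding eventually_at_right_field by (intro exI[of _ 1]) (simp add: scaleR_diff_right)
  moreover have "((\<lambda>h. (1 / h) *\<^sub>R integral {t..t + h} (\<lambda>s. S s x)
      - (1 / h) *\<^sub>R integral {0..0 + h} (\<lambda>s. S s x)) \<longlongrightarrow> S t x - S 0 x) (at_right 0)"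
    using assms(1) by (intro tendsto_diff average) auto
  ultimately show ?thesis by (simp add: S_zero tendsto_cong)
qed

text \<open>For a second-order equation, \<open>P\<close> reads off the position and \<open>Q\<close> the velocity of a state. The
  hypothesis \<open>kin\<close> says that velocity is the derivative of position along free orbits; forces
  change only the velocity, \<open>P (g s) = 0\<close>. A force acting at time \<open>s\<close> therefore displaces the
  position at time \<open>t\<close> only by \<open>O(t - s)\<close>, and over a short interval the total displacement is
  the length of the interval times an integral which tends to \<open>0\<close>. Left and right derivatives
  are treated together by restarting at the earlier of the two times.\<close>

lemma mild_solution_kinematics:
  fixes P Q :: "'z \<Rightarrow> 'h::banach"
  assumes P: "bounded_linear P" and Q: "bounded_linear Q"
    and kin: "\<And>t x. 0 \<le> t \<Longrightarrow> P (S t x) - P x = integral {0..t} (\<lambda>s. Q (S s x))"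
    and u: "continuous_on {0..} u"
    and mild: "\<And>t. 0 \<le> t \<Longrightarrow> ((\<lambda>s. S (t - s) (g s)) has_integral (u t - S t (u 0))) {0..t}"
    and Pg: "\<And>s. 0 \<le> s \<Longrightarrow> P (g s) = 0"
    and \<beta>: "\<And>t. \<beta> integrable_on {0..t}" and g_\<beta>: "\<And>s. 0 \<le> s \<Longrightarrow> norm (g s) \<le> \<beta> s"
    and t: "0 \<le> t"
  shows "((\<lambda>s. P (u s)) has_vector_derivative Q (u t)) (at t within {0..})"
proof -
  obtain q where q: "q > 0" "\<And>x. norm (Q x) \<le> norm x * q"
    using bounded_linear.pos_bounded[OF Q] by auto
  have QS_cont: "continuous_on {0..r} (\<lambda>s. Q (S s x))" for r x
    by (intro bounded_linear.continuous_on[OF Q] continuous_on_S continuous_intros) auto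
  have incr: "norm (P (u y) - P (u r) - (y - r) *\<^sub>R Q (u t)) \<le>
      (y - r) * (q * e + q * M * integral {r..y} \<beta>)"
    if ry: "0 \<le> r" "r \<le> y" and near: "\<And>h. 0 \<le> h \<Longrightarrow> h \<le> y - r \<Longrightarrow> norm (S h (u r) - u t) \<le> e"
    for r y e
  proof -
    have "((P \<circ> (\<lambda>s. S (y - s) (g s))) has_integral P (u y - S (y - r) (u r))) {r..y}"
      using mild_solution_restart[OF mild ry] by (intro has_integral_linear P) auto
    then have forced: "((\<lambda>s. P (S (y - s) (g s))) has_integral P (u y - S (y - r) (u r))) {r..y}"
      by (simp add: o_def)
    have \<beta>_int: "\<beta> integrable_on {r..y}"
      using ry by (intro integrable_subinterval_real[OF \<beta>[of y]]) auto
    \<comment> \<open>The forcing is invisible to \<open>P\<close> at the time it acts, so that it moves \<open>P\<close> only by the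
      elapsed time times its size.\<close>
    have "norm (P (S (y - s) (g s))) \<le> (y - r) * (q * M) * \<beta> s" if s: "s \<in> {r..y}" for s
    proof -
      have "P (S (y - s) (g s)) = integral {0..y - s} (\<lambda>r. Q (S r (g s)))"
        using kin[of "y - s" "g s"] Pg[of s] s ry by simp
      also have "norm \<dots> \<le> (q * M * \<beta> s) * (y - s - 0)"
      proof (rule integral_bound[OF _ QS_cont])
        fix r' assume r': "r' \<in> {0..y - s}"
        have "norm (Q (S r' (g s))) \<le> norm (S r' (g s)) * q" by (rule q)
        also have "\<dots> \<le> (M * \<beta> s) * q"
          using S_bound_const[of r' "g s"] g_\<beta>[of s] r' s ry q(1) M_pos
          by (intro mult_right_mono) (auto intro: order_trans mult_left_mono)
        finally show "norm (Q (S r' (g s))) \<le> q * M * \<beta> s" by (simp add: algebra_simps)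
      qed (use s in simp)
      also have "\<dots> \<le> (q * M * \<beta> s) * (y - r)"
        using s q(1) M_pos order_trans[OF norm_ge_zero g_\<beta>[of s]] ry
        by (intro mult_left_mono mult_nonneg_nonneg) auto
      finally show ?thesis by (simp add: algebra_simps)
    qed
    then have "norm (integral {r..y} (\<lambda>s. P (S (y - s) (g s)))) \<le> integral {r..y} (\<lambda>s. (y - r) * (q * M) * \<beta> s)"
      by (intro integral_norm_bound_integral has_integral_integrable[OF forced] integrable_on_mult_right \<beta>_int)
    then have 1: "norm (P (u y) - P (S (y - r) (u r))) \<le> (y - r) * (q * M * integral {r..y} \<beta>)"
      using forced by (simp add: integral_unique linear_diff[OF bounded_linear.linear[OF P]] mult.assoc)
    have "P (S (y - r) (u r)) - P (u r) - (y - r) *\<^sub>R Q (u t) = integral {0..y - r} (\<lambda>s. Q (S s (u r)) - Q (u t))"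
      using kin[of "y - r" "u r"] ry
      by (subst integral_diff) (auto intro!: integrable_continuous_real QS_cont)
    also have "norm \<dots> \<le> (q * e) * (y - r - 0)"
    proof (rule integral_bound)
      show "continuous_on {0..y - r} (\<lambda>s. Q (S s (u r)) - Q (u t))"
        by (intro continuous_intros QS_cont)
      fix s assume s: "s \<in> {0..y - r}"
      have "Q (S s (u r)) - Q (u t) = Q (S s (u r) - u t)"
        by (simp add: linear_diff[OF bounded_linear.linear[OF Q]])
      also have "norm \<dots> \<le> norm (S s (u r) - u t) * q" by (rule q)
      also have "\<dots> \<le> e * q" using near[of s] s q(1) by (intro mult_right_mono) auto
      finally show "norm (Q (S s (u r)) - Q (u t)) \<le> q * e" by (simp add: mult.commute)
    qed (use ry in simp)
    finally have 2: "norm (P (S (y - r) (u r)) - P (u r) - (y - r) *\<^sub>R Q (u t)) \<le> (y - r) * (q * e)"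
      by (simp add: algebra_simps)
    have "P (u y) - P (u r) - (y - r) *\<^sub>R Q (u t) = (P (u y) - P (S (y - r) (u r)))
        + (P (S (y - r) (u r)) - P (u r) - (y - r) *\<^sub>R Q (u t))" by simp
    also have "norm \<dots> \<le> (y - r) * (q * M * integral {r..y} \<beta>) + (y - r) * (q * e)"
      using 1 2 by (rule norm_triangle_mono)
    finally show ?thesis by (simp add: algebra_simps)
  qed
  have joint: "continuous_on ({0..} \<times> {0..}) (\<lambda>p. S (fst p) (u (snd p)))"
    by (intro continuous_on_S continuous_intros continuous_on_compose2[OF u]) auto
  have \<beta>_cont: "continuous_on {0..t + 1} (\<lambda>y. integral {0..y} \<beta>)"
    by (rule indefinite_integral_continuous_1[OF \<beta>])
  show ?thesis
    unfolding has_vector_derivative_def has_derivative_within_alt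
  proof (intro conjI allI impI)
    show "bounded_linear (\<lambda>h. h *\<^sub>R Q (u t))" by (rule bounded_linear_scaleR_left)
    fix e :: real assume "e > 0"
    define e1 where "e1 = e / (2 * q)"
    define e2 where "e2 = e / (2 * q * M)"
    have e12: "e1 > 0" "e2 > 0" using \<open>e > 0\<close> q(1) M_pos by (auto simp: e1_def e2_def)
    obtain d1 where d1: "d1 > 0" "\<And>p. p \<in> {0..} \<times> {0..} \<Longrightarrow> dist p (0, t) < d1 \<Longrightarrow>
        dist (S (fst p) (u (snd p))) (S 0 (u t)) < e1"
      using joint e12(1) t unfolding continuous_on_iff
      by (elim ballE[of _ _ "(0, t)"] allE[of _ e1]) auto
    obtain d2 where d2: "d2 > 0" "\<And>y. y \<in> {0..t + 1} \<Longrightarrow> dist y t < d2 \<Longrightarrow>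
        dist (integral {0..y} \<beta>) (integral {0..t} \<beta>) < e2"
      using \<beta>_cont e12(2) t unfolding continuous_on_iff
      by (elim ballE[of _ _ t] allE[of _ e2]) auto
    show "\<exists>d>0. \<forall>y\<in>{0..}. norm (y - t) < d \<longrightarrow>
        norm (P (u y) - P (u t) - (y - t) *\<^sub>R Q (u t)) \<le> e * norm (y - t)"
    proof (intro exI[of _ "min 1 (min (d1 / 2) d2)"] conjI ballI impI)
      show "0 < min 1 (min (d1 / 2) d2)" using d1 d2 by simp
      fix y :: real assume y: "y \<in> {0..}" "norm (y - t) < min 1 (min (d1 / 2) d2)"
      have near: "norm (S h (u r) - u t) \<le> e1" if "0 \<le> h" "h \<le> \<bar>y - t\<bar>" "r = y \<or> r = t" for h r
      proof -
        have "dist (h, r) (0, t) \<le> \<bar>h\<bar> + \<bar>r - t\<bar>"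
          unfolding dist_Pair_Pair dist_real_def using sqrt_sum_squares_le_sum_abs[of "h - 0" "r - t"] by simp
        also have "\<dots> < d1" using that y by auto
        finally show ?thesis
          using d1(2)[of "(h, r)"] that y t by (auto simp: dist_norm S_zero)
      qed
      have \<beta>_near: "norm (integral {0..y} \<beta> - integral {0..t} \<beta>) < e2"
        using d2(2)[of y] y t by (auto simp: dist_real_def)
      have e_eq: "q * e1 + q * M * e2 = e" using q(1) M_pos by (simp add: e1_def e2_def)
      have fin: "(z - r) * (q * e1 + q * M * integral {r..z} \<beta>) \<le> e * (z - r)"
        if "0 \<le> r" "r \<le> z" "{r, z} = {y, t}" for r z
      proof -
        have "integral {r..z} \<beta> = integral {0..z} \<beta> - integral {0..r} \<beta>"
          using Henstock_Kurzweil_Integration.integral_combine[OF that(1,2) \<beta>] by simp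
        also have "\<dots> \<le> e2" using \<beta>_near that(3) by (auto simp: doubleton_eq_iff)
        finally have "q * e1 + q * M * integral {r..z} \<beta> \<le> e"
          using q(1) M_pos by (subst e_eq[symmetric]) (intro add_left_mono mult_left_mono, auto)
        then have "(z - r) * (q * e1 + q * M * integral {r..z} \<beta>) \<le> (z - r) * e"
          using that(2) by (intro mult_left_mono) auto
        then show ?thesis by (simp add: mult.commute)
      qed
      show "norm (P (u y) - P (u t) - (y - t) *\<^sub>R Q (u t)) \<le> e * norm (y - t)"
      proof (cases "t \<le> y")
        case True
        then have "norm (P (u y) - P (u t) - (y - t) *\<^sub>R Q (u t)) \<le> (y - t) * (q * e1 + q * M * integral {t..y} \<beta>)"
          using t by (intro incr near) auto
        also have "\<dots> \<le> e * (y - t)" using True t by (intro fin) auto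
        finally show ?thesis using True by simp
      next
        case False
        have "norm (P (u t) - P (u y) - (t - y) *\<^sub>R Q (u t)) \<le> (t - y) * (q * e1 + q * M * integral {y..t} \<beta>)"
          using False y(1) by (intro incr near) auto
        also have "\<dots> \<le> e * (t - y)" using False y(1) by (intro fin) auto
        also have "P (u t) - P (u y) - (t - y) *\<^sub>R Q (u t) = - (P (u y) - P (u t) - (y - t) *\<^sub>R Q (u t))"
          by (simp add: algebra_simps)
        finally show ?thesis using False by (simp add: norm_minus_commute)
      qed
    qed
  qed
qed

end

section \<open>Semilinear evolution equations with delay\<close>

lemma continuous_on_atLeastI:
  fixes f :: "real \<Rightarrow> 'b::topological_space"
  assumes "\<And>T. continuous_on {a..T} f"
  shows "continuous_on {a..} f"
  unfolding continuous_on_eq_continuous_within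
proof
  fix t assume t: "t \<in> {a..}"
  have "at t within {a..} = at t within {a..t + 1}"
    using t by (intro at_within_nhd[of _ "{..<t + 1}"]) auto
  moreover have "continuous (at t within {a..t + 1}) f"
    using assms[of "t + 1"] t by (auto simp: continuous_on_eq_continuous_within)
  ultimately show "continuous (at t within {a..}) f" by (simp add: continuous_within)
qed

text \<open>The equation \<open>u' = G u + \<alpha>(t) D u(t - \<tau>) + N1 (u(t)) + N2 (u(t - \<tau>))\<close>, where \<open>G\<close> generates \<open>S\<close>. The
  history \<open>\<phi>\<close> is taken to be defined and continuous on all of \<open>{..0}\<close>; then every function below
  lives on the whole real line, and the fixed point can be sought among functions in \<open>bcontfun\<close>.\<close>

locale delayed_evolution = stable_semigroup S M \<omega>
  for S :: "real \<Rightarrow> 'z::banach \<Rightarrow> 'z" and M \<omega> :: real +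
  fixes D N1 N2 :: "'z \<Rightarrow> 'z" and \<alpha> :: "real \<Rightarrow> real" and \<tau> b :: real and \<phi> :: "real \<Rightarrow> 'z"
  assumes \<tau>_pos: "0 < \<tau>"
    and bounded_linear_D: "bounded_linear D" and D_bound: "norm (D x) \<le> b * norm x"
    and b_nonneg: "0 \<le> b"
    and N_zero: "N1 0 = 0" "N2 0 = 0"
    and N_lipschitz: "\<exists>\<eta>\<ge>0. \<forall>x y. norm x \<le> R \<longrightarrow> norm y \<le> R \<longrightarrow>
          norm (N1 x - N1 y) \<le> \<eta> * norm (x - y) \<and> norm (N2 x - N2 y) \<le> \<eta> * norm (x - y)"
    and \<alpha>_integrable: "0 \<le> t \<Longrightarrow> \<alpha> absolutely_integrable_on {0..t}"
    and \<phi>_continuous: "continuous_on {..0} \<phi>"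
begin

definition rhs :: "(real \<Rightarrow> 'z) \<Rightarrow> real \<Rightarrow> 'z" where
  "rhs u s = \<alpha> s *\<^sub>R D (u (s - \<tau>)) + (N1 (u s) + N2 (u (s - \<tau>)))"

definition mild_solution :: "(real \<Rightarrow> 'z) \<Rightarrow> bool" where
  "mild_solution u \<longleftrightarrow> continuous_on {-\<tau>..} u \<and> (\<forall>t\<in>{-\<tau>..0}. u t = \<phi> t) \<and>
     (\<forall>t\<ge>0. ((\<lambda>s. S (t - s) (rhs u s)) has_integral (u t - S t (u 0))) {0..t})"

text \<open>The delayed value \<open>u (s - \<tau>)\<close> enters at time \<open>s\<close> with weight \<open>b \<bar>\<alpha> s\<bar> + \<eta>\<close>, where \<open>\<eta>\<close> is a Lipschitz
  constant of \<open>N1\<close> and \<open>N2\<close>. Booked at the time when it was taken, and measured relative to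
  \<open>exp (- \<omega> s)\<close>, it contributes the first summand of \<open>rate\<close>; the second comes from \<open>N1 (u s)\<close>. The
  history is read from \<open>-\<tau>\<close> on, so \<open>growth\<close> starts there.\<close>

definition rate :: "real \<Rightarrow> real \<Rightarrow> real" where
  "rate \<eta> s = M * exp (\<omega> * \<tau>) * (b * \<bar>\<alpha> (s + \<tau>)\<bar> + \<eta>) + M * \<eta>"

definition growth :: "real \<Rightarrow> real \<Rightarrow> real" where
  "growth \<eta> t = integral {-\<tau>..t} (rate \<eta>)"

lemma abs_\<alpha>_integrable: "(\<lambda>s. \<bar>\<alpha> s\<bar>) integrable_on {0..t}"
  using \<alpha>_integrable[of t] by (cases "0 \<le> t") (auto simp: absolutely_integrable_on_def)

lemma abs_\<alpha>_shift_integrable: "(\<lambda>s. \<bar>\<alpha> (s + \<tau>)\<bar>) integrable_on {-\<tau>..t}"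
  using integrable_shift_real_ivl[OF abs_\<alpha>_integrable[of "t + \<tau>"], of \<tau>] by simp

lemma rate_integrable: "rate \<eta> integrable_on {-\<tau>..t}"
  unfolding rate_def[abs_def] using abs_\<alpha>_shift_integrable[of t]
  by (intro integrable_add integrable_on_mult_right) auto

lemma rate_nonneg: "0 \<le> \<eta> \<Longrightarrow> 0 \<le> rate \<eta> s"
  using M_pos b_nonneg by (simp add: rate_def)

lemma growth_nonneg: "0 \<le> \<eta> \<Longrightarrow> 0 \<le> growth \<eta> t"
  unfolding growth_def by (intro integral_nonneg rate_integrable rate_nonneg)

lemma continuous_on_growth: "continuous_on A (growth \<eta>)"
proof -
  have "continuous_on {-\<tau>..} (growth \<eta>)"
    unfolding growth_def by (intro continuous_on_atLeastI indefinite_integral_continuous_1 rate_integrable)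
  moreover have "growth \<eta> t = 0" if "t \<le> -\<tau>" for t
    using that by (cases "t = -\<tau>") (auto simp: growth_def)
  then have "continuous_on {..-\<tau>} (growth \<eta>)"
    by (subst continuous_on_cong[where g = "\<lambda>_. 0"]) auto
  ultimately have "continuous_on ({..-\<tau>} \<union> {-\<tau>..}) (growth \<eta>)"
    by (intro continuous_on_closed_Un) auto
  then show ?thesis by (rule continuous_on_subset) auto
qed

lemma N_continuous: "continuous_on A N1" "continuous_on A N2"
proof -
  have "isCont N1 x \<and> isCont N2 x" for x
  proof -
    obtain \<eta> where "\<eta> \<ge> 0" and \<eta>: "\<And>y z. norm y \<le> norm x + 1 \<Longrightarrow> norm z \<le> norm x + 1 \<Longrightarrow>
        norm (N1 y - N1 z) \<le> \<eta> * norm (y - z) \<and> norm (N2 y - N2 z) \<le> \<eta> * norm (y - z)"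
      using N_lipschitz by metis
    have near: "eventually (\<lambda>y. norm y \<le> norm x + 1) (at x)"
      unfolding eventually_at
    proof (intro exI[of _ 1] conjI ballI impI)
      show "norm y \<le> norm x + 1" if "y \<noteq> x \<and> dist y x < 1" for y
        using that norm_triangle_sub[of y x] by (auto simp: dist_norm)
    qed simp
    have lim: "((\<lambda>y. \<eta> * norm (y - x)) \<longlongrightarrow> 0) (at x)"
      by (rule tendsto_eq_intros | simp)+
    have "((\<lambda>y. N1 y - N1 x) \<longlongrightarrow> 0) (at x)" "((\<lambda>y. N2 y - N2 x) \<longlongrightarrow> 0) (at x)"
      using eventually_mono[OF near] \<eta>[of _ x] by (auto intro!: Lim_null_comparison[OF _ lim])
    then show ?thesis unfolding isCont_def by (auto simp: Lim_null[symmetric])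
  qed
  then show "continuous_on A N1" "continuous_on A N2"
    by (auto intro: continuous_at_imp_continuous_on)
qed

lemma continuous_on_delay_terms:
  assumes u: "continuous_on {-\<tau>..} u"
  shows "continuous_on {0..T} (\<lambda>s. D (u (s - \<tau>)))"
    and "continuous_on {0..T} (\<lambda>s. N1 (u s) + N2 (u (s - \<tau>)))"
proof -
  show "continuous_on {0..T} (\<lambda>s. D (u (s - \<tau>)))"
    by (intro bounded_linear.continuous_on[OF bounded_linear_D] continuous_on_compose2[OF u]
        continuous_intros) auto
  show "continuous_on {0..T} (\<lambda>s. N1 (u s) + N2 (u (s - \<tau>)))"
    using \<tau>_pos
    by (intro continuous_on_add continuous_on_compose2[OF N_continuous(1)[of UNIV]]
        continuous_on_compose2[OF N_continuous(2)[of UNIV]] continuous_on_compose2[OF u]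
        continuous_intros) auto
qed

lemma rhs_integrable_majorant:
  assumes u: "continuous_on {-\<tau>..} u"
  obtains \<beta> where "\<And>t. \<beta> integrable_on {0..t}" "\<And>s. norm (rhs u s) \<le> \<beta> s"
proof
  note cont = continuous_on_delay_terms[OF u]
  define \<beta> where "\<beta> s = \<bar>\<alpha> s\<bar> *\<^sub>R norm (D (u (s - \<tau>))) + norm (N1 (u s) + N2 (u (s - \<tau>)))" for s
  have "(\<lambda>s. \<bar>\<alpha> s\<bar>) absolutely_integrable_on {0..t}" for t
    by (rule nonnegative_absolutely_integrable_1[OF abs_\<alpha>_integrable]) simp
  then show "\<beta> integrable_on {0..t}" for t
    unfolding \<beta>_def
    by (intro integrable_add integrable_scaleR_continuous integrable_continuous_real
        continuous_on_norm cont)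
  show "norm (rhs u s) \<le> \<beta> s" for s
    unfolding rhs_def \<beta>_def by (rule norm_triangle_mono) auto
qed

lemma duhamel_integrable_continuous:
  assumes u: "continuous_on {-\<tau>..} u"
  shows "(\<lambda>s. S (t - s) (rhs u s)) integrable_on {0..t}"
    and "continuous_on {0..} (\<lambda>t. integral {0..t} (\<lambda>s. S (t - s) (rhs u s)))"
proof -
  note Du = continuous_on_delay_terms(1)[OF u] and Nu = continuous_on_delay_terms(2)[OF u]
  have one: "(\<lambda>_. 1 :: real) absolutely_integrable_on {0..T}" for T :: real
    by (intro absolutely_integrable_continuous_real continuous_intros)
  have \<alpha>: "\<alpha> absolutely_integrable_on {0..T}" for T
    using \<alpha>_integrable[of T] by (cases "0 \<le> T") auto
  have split: "S (t - s) (rhs u s) = \<alpha> s *\<^sub>R S (t - s) (D (u (s - \<tau>)))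
      + 1 *\<^sub>R S (t - s) (N1 (u s) + N2 (u (s - \<tau>)))" if "s \<in> {0..t}" for s t
    using that bounded_linear_S[of "t - s"]
    by (simp add: rhs_def linear_add[OF bounded_linear.linear] linear_scale[OF bounded_linear.linear])
  have int1: "(\<lambda>s. \<alpha> s *\<^sub>R S (t - s) (D (u (s - \<tau>)))) integrable_on {0..t}" for t
    by (intro convolution_integrable \<alpha> Du)
  have int2: "(\<lambda>s. 1 *\<^sub>R S (t - s) (N1 (u s) + N2 (u (s - \<tau>)))) integrable_on {0..t}" for t
    by (intro convolution_integrable one Nu)
  show "(\<lambda>s. S (t - s) (rhs u s)) integrable_on {0..t}"
    by (rule integrable_eq[OF integrable_add[OF int1 int2]]) (simp add: split)
  have "integral {0..t} (\<lambda>s. S (t - s) (rhs u s)) =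
      integral {0..t} (\<lambda>s. \<alpha> s *\<^sub>R S (t - s) (D (u (s - \<tau>))))
      + integral {0..t} (\<lambda>s. 1 *\<^sub>R S (t - s) (N1 (u s) + N2 (u (s - \<tau>))))" for t
    by (subst integral_add[OF int1 int2, symmetric]) (rule integral_cong, rule split)
  then show "continuous_on {0..} (\<lambda>t. integral {0..t} (\<lambda>s. S (t - s) (rhs u s)))"
    by (simp only:) (intro continuous_on_atLeastI continuous_on_add continuous_on_convolution \<alpha> Du one Nu)
qed

text \<open>If the forcing \<open>g\<close> is dominated as the difference of the right-hand sides would be by a
  difference of solutions of size \<open>c exp (\<kappa> growth - \<omega> t)\<close>, then its response is of the same
  form, divided by \<open>\<kappa>\<close> and with \<open>1\<close> subtracted from the exponential. The case \<open>\<kappa> = 1\<close> gives an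
  invariant set of the Picard map, the case \<open>\<kappa> = 2\<close> a contraction.\<close>

lemma duhamel_bound:
  assumes J: "((\<lambda>s. S (t - s) (g s)) has_integral J) {0..t}" and "0 \<le> t"
    and "0 \<le> \<eta>" "0 \<le> c" "0 < \<kappa>"
  defines "\<mu> \<equiv> \<lambda>s. exp (\<kappa> * growth \<eta> s - \<omega> * s)"
  assumes g: "\<And>s. s \<in> {0..t} \<Longrightarrow> norm (g s) \<le> c * ((b * \<bar>\<alpha> s\<bar> + \<eta>) * \<mu> (s - \<tau>) + \<eta> * \<mu> s)"
  shows "norm J \<le> c / \<kappa> * exp (- \<omega> * t) * (exp (\<kappa> * growth \<eta> t) - 1)"
proof -
  define E where "E s = exp (\<kappa> * growth \<eta> s)" for s
  define p where "p s = M * exp (\<omega> * \<tau>) * (b * \<bar>\<alpha> s\<bar> + \<eta>)" for s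
  have E_cont: "continuous_on A E" for A
    unfolding E_def by (intro continuous_intros continuous_on_growth)
  have p_nonneg: "0 \<le> p s" for s using M_pos b_nonneg \<open>0 \<le> \<eta>\<close> by (simp add: p_def)
  have p_int: "p absolutely_integrable_on {0..r}" for r
  proof (rule nonnegative_absolutely_integrable_1)
    show "p integrable_on {0..r}" unfolding p_def[abs_def]
      by (intro integrable_on_mult_right integrable_add abs_\<alpha>_integrable) auto
  qed (rule p_nonneg)
  have pE: "(\<lambda>s. p s * E (s - \<tau>)) integrable_on {0..r}" for r
    using integrable_scaleR_continuous[OF p_int, of r "\<lambda>s. E (s - \<tau>)"]
    by (simp add: continuous_on_compose2[OF E_cont[of UNIV]] continuous_intros)
  have pE': "(\<lambda>s. p (s + \<tau>) * E s) integrable_on {-\<tau>..t}"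
    using integrable_shift_real_ivl[OF pE[of "t + \<tau>"], of \<tau>] by simp
  have E_int: "(\<lambda>s. M * \<eta> * E s) integrable_on {x..y}" for x y
    by (intro integrable_continuous_real continuous_intros E_cont)
  have bound: "norm (S (t - s) (g s)) \<le> c * exp (- \<omega> * t) * (p s * E (s - \<tau>) + M * \<eta> * E s)"
    if s: "s \<in> {0..t}" for s
  proof -
    have "norm (S (t - s) (g s)) \<le> M * exp (- \<omega> * (t - s)) * norm (g s)"
      using s by (intro S_bound) auto
    also have "\<dots> \<le> M * exp (- \<omega> * (t - s)) * (c * ((b * \<bar>\<alpha> s\<bar> + \<eta>) * \<mu> (s - \<tau>) + \<eta> * \<mu> s))"
      using g[OF s] M_pos by (intro mult_left_mono) auto
    also have "\<dots> = c * exp (- \<omega> * t) * (p s * E (s - \<tau>) + M * \<eta> * E s)"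
    proof -
      have "exp (- \<omega> * (t - s)) * \<mu> (s - \<tau>) = exp (- \<omega> * t) * exp (\<omega> * \<tau>) * E (s - \<tau>)"
        and "exp (- \<omega> * (t - s)) * \<mu> s = exp (- \<omega> * t) * E s"
        by (simp_all add: \<mu>_def E_def exp_add[symmetric] algebra_simps)
      then show ?thesis by (simp add: p_def algebra_simps)
    qed
    finally show ?thesis .
  qed
  have "norm J = norm (integral {0..t} (\<lambda>s. S (t - s) (g s)))" using J by (simp add: integral_unique)
  also have "\<dots> \<le> integral {0..t} (\<lambda>s. c * exp (- \<omega> * t) * (p s * E (s - \<tau>) + M * \<eta> * E s))"
    by (intro integral_norm_bound_integral has_integral_integrable[OF J] integrable_on_mult_right
        integrable_add pE E_int bound)
  also have "\<dots> = c * exp (- \<omega> * t) * (integral {0..t} (\<lambda>s. p s * E (s - \<tau>)) + integral {0..t} (\<lambda>s. M * \<eta> * E s))"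
    by (simp only: integral_mult_right integral_add[OF pE E_int])
  also have "\<dots> \<le> c * exp (- \<omega> * t) * ((exp (\<kappa> * growth \<eta> t) - 1) / \<kappa>)"
  proof (rule mult_left_mono)
    \<comment> \<open>Reading the delayed values at the time they were taken turns the delay into the shifted
      rate on \<open>[-\<tau>, t - \<tau>]\<close>.\<close>
    have "((\<lambda>s. p (s + \<tau>) * E s) has_integral integral {0..t} (\<lambda>s. p s * E (s - \<tau>))) {0 - \<tau>..t - \<tau>}"
      using has_integral_shift_real_ivl[OF integrable_integral[OF pE[of t]], of \<tau>] by simp
    then have "integral {0..t} (\<lambda>s. p s * E (s - \<tau>)) = integral {-\<tau>..t - \<tau>} (\<lambda>s. p (s + \<tau>) * E s)"
      by (simp add: integral_unique)
    also have "\<dots> \<le> integral {-\<tau>..t} (\<lambda>s. p (s + \<tau>) * E s)"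
      using \<tau>_pos p_nonneg
      by (intro integral_subset_le integrable_subinterval_real[OF pE'] pE') (auto simp: E_def)
    finally have 1: "integral {0..t} (\<lambda>s. p s * E (s - \<tau>)) \<le> integral {-\<tau>..t} (\<lambda>s. p (s + \<tau>) * E s)" .
    have 2: "integral {0..t} (\<lambda>s. M * \<eta> * E s) \<le> integral {-\<tau>..t} (\<lambda>s. M * \<eta> * E s)"
      using \<tau>_pos M_pos \<open>0 \<le> \<eta>\<close> by (intro integral_subset_le E_int) (auto simp: E_def)
    have "integral {-\<tau>..t} (\<lambda>s. p (s + \<tau>) * E s) + integral {-\<tau>..t} (\<lambda>s. M * \<eta> * E s)
        = integral {-\<tau>..t} (\<lambda>s. rate \<eta> s * exp (\<kappa> * integral {-\<tau>..s} (rate \<eta>)))"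
      by (subst integral_add[OF pE' E_int, symmetric], rule integral_cong)
        (simp add: p_def E_def rate_def[of \<eta>] growth_def algebra_simps)
    also have "\<dots> \<le> (exp (\<kappa> * growth \<eta> t) - 1) / \<kappa>"
      using integral_exp_integral_le(2)[OF rate_integrable[of \<eta> t] rate_nonneg, of \<kappa>]
        \<tau>_pos assms by (simp add: growth_def)
    finally show "integral {0..t} (\<lambda>s. p s * E (s - \<tau>)) + integral {0..t} (\<lambda>s. M * \<eta> * E s)
        \<le> (exp (\<kappa> * growth \<eta> t) - 1) / \<kappa>" using 1 2 by linarith
  qed (use \<open>0 \<le> c\<close> in simp)
  finally show ?thesis by (simp add: field_simps)
qed

lemma rhs_diff_bound:
  assumes lip: "\<And>x y. norm x \<le> R \<Longrightarrow> norm y \<le> R \<Longrightarrow>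
      norm (N1 x - N1 y) \<le> \<eta> * norm (x - y) \<and> norm (N2 x - N2 y) \<le> \<eta> * norm (x - y)"
    and R: "norm (u s) \<le> R" "norm (v s) \<le> R" "norm (u (s - \<tau>)) \<le> R" "norm (v (s - \<tau>)) \<le> R"
    and \<eta>: "0 \<le> \<eta>"
    and close: "norm (u s - v s) \<le> c * y" "norm (u (s - \<tau>) - v (s - \<tau>)) \<le> c * z"
  shows "norm (rhs u s - rhs v s) \<le> c * ((b * \<bar>\<alpha> s\<bar> + \<eta>) * z + \<eta> * y)"
proof -
  have "rhs u s - rhs v s = \<alpha> s *\<^sub>R D (u (s - \<tau>) - v (s - \<tau>))
      + ((N1 (u s) - N1 (v s)) + (N2 (u (s - \<tau>)) - N2 (v (s - \<tau>))))"
    by (simp add: rhs_def linear_diff[OF bounded_linear.linear[OF bounded_linear_D]] scaleR_diff_right)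
  also have "norm \<dots> \<le> \<bar>\<alpha> s\<bar> * (b * (c * z)) + (\<eta> * (c * y) + \<eta> * (c * z))"
  proof (intro norm_triangle_mono)
    show "norm (\<alpha> s *\<^sub>R D (u (s - \<tau>) - v (s - \<tau>))) \<le> \<bar>\<alpha> s\<bar> * (b * (c * z))"
      using D_bound[of "u (s - \<tau>) - v (s - \<tau>)"] mult_left_mono[OF close(2) b_nonneg]
      by (simp add: mult_left_mono)
    show "norm (N1 (u s) - N1 (v s)) \<le> \<eta> * (c * y)"
      using lip[OF R(1,2)] mult_left_mono[OF close(1) \<eta>] by linarith
    show "norm (N2 (u (s - \<tau>)) - N2 (v (s - \<tau>))) \<le> \<eta> * (c * z)"
      using lip[OF R(3,4)] mult_left_mono[OF close(2) \<eta>] by linarith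
  qed
  finally show ?thesis by (simp add: algebra_simps)
qed

text \<open>The difference of two solutions, divided by the weight \<open>exp (2 growth - \<omega> t)\<close>, attains its
  maximum on \<open>{-\<tau>..T}\<close>, and by \<open>duhamel_bound\<close> with \<open>\<kappa> = 2\<close> this maximum is at most half of itself.\<close>

lemma mild_solution_unique:
  assumes u: "mild_solution u" and v: "mild_solution v" and "-\<tau> \<le> T"
  shows "u T = v T"
proof -
  have cont: "continuous_on {-\<tau>..T} u" "continuous_on {-\<tau>..T} v"
    using u v by (auto simp: mild_solution_def intro: continuous_on_subset)
  then have "bounded (u ` {-\<tau>..T} \<union> v ` {-\<tau>..T})"
    by (auto intro!: compact_imp_bounded compact_continuous_image)
  then obtain R where R: "\<And>s. s \<in> {-\<tau>..T} \<Longrightarrow> norm (u s) \<le> R \<and> norm (v s) \<le> R"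
    unfolding bounded_iff by blast
  obtain \<eta> where "0 \<le> \<eta>" and lip: "\<And>x y. norm x \<le> R \<Longrightarrow> norm y \<le> R \<Longrightarrow>
      norm (N1 x - N1 y) \<le> \<eta> * norm (x - y) \<and> norm (N2 x - N2 y) \<le> \<eta> * norm (x - y)"
    using N_lipschitz by metis
  define \<mu> where "\<mu> s = exp (2 * growth \<eta> s - \<omega> * s)" for s
  have \<mu>_cont: "continuous_on A \<mu>" for A
    unfolding \<mu>_def by (intro continuous_intros continuous_on_growth)
  have \<mu>_pos: "0 < \<mu> s" for s by (simp add: \<mu>_def)
  define d where "d s = norm (u s - v s) / \<mu> s" for s
  have "continuous_on {-\<tau>..T} d"
    unfolding d_def using \<mu>_pos by (intro continuous_intros cont \<mu>_cont) (auto simp: less_imp_neq[symmetric])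
  then obtain r where r: "r \<in> {-\<tau>..T}" and max: "\<And>s. s \<in> {-\<tau>..T} \<Longrightarrow> d s \<le> d r"
    using continuous_attains_sup[of "{-\<tau>..T}" d] \<open>-\<tau> \<le> T\<close> by auto
  have init: "u s = v s" if "s \<in> {-\<tau>..0}" for s
    using that u v by (auto simp: mild_solution_def)
  have "d r \<le> 0"
  proof (cases "r \<le> 0")
    case True
    then show ?thesis using init[of r] r by (simp add: d_def)
  next
    case False
    have "((\<lambda>s. S (r - s) (rhs u s) - S (r - s) (rhs v s)) has_integral
        ((u r - S r (u 0)) - (v r - S r (v 0)))) {0..r}"
      using u v False by (intro has_integral_diff) (auto simp: mild_solution_def)
    moreover have "(u r - S r (u 0)) - (v r - S r (v 0)) = u r - v r"
      using init[of 0] \<tau>_pos by simp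
    ultimately have diff: "((\<lambda>s. S (r - s) (rhs u s - rhs v s)) has_integral (u r - v r)) {0..r}"
      by (subst has_integral_cong[where g = "\<lambda>s. S (r - s) (rhs u s) - S (r - s) (rhs v s)"])
        (auto simp: S_diff)
    have close: "norm (u s - v s) \<le> d r * \<mu> s" if "s \<in> {-\<tau>..T}" for s
      using max[OF that] \<mu>_pos[of s] by (simp add: d_def pos_divide_le_eq)
    have "norm (u r - v r) \<le> d r / 2 * exp (- \<omega> * r) * (exp (2 * growth \<eta> r) - 1)"
    proof (rule duhamel_bound[OF diff, of \<eta>])
      show "0 \<le> d r" using \<mu>_pos[of r] by (simp add: d_def)
      fix s assume s: "s \<in> {0..r}"
      then have *: "s \<in> {-\<tau>..T}" "s - \<tau> \<in> {-\<tau>..T}" using r \<tau>_pos by auto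
      show "norm (rhs u s - rhs v s) \<le> d r * ((b * \<bar>\<alpha> s\<bar> + \<eta>) * exp (2 * growth \<eta> (s - \<tau>) - \<omega> * (s - \<tau>))
          + \<eta> * exp (2 * growth \<eta> s - \<omega> * s))"
        using R[OF *(1)] R[OF *(2)] close[OF *(1)] close[OF *(2)] \<open>0 \<le> \<eta>\<close> unfolding \<mu>_def
        by (intro rhs_diff_bound[OF lip]) auto
    qed (use False \<open>0 \<le> \<eta>\<close> in auto)
    also have "\<dots> \<le> d r / 2 * \<mu> r"
    proof -
      have "exp (- \<omega> * r) * (exp (2 * growth \<eta> r) - 1) \<le> \<mu> r"
        by (simp add: \<mu>_def exp_diff exp_minus field_simps)
      moreover have "0 \<le> d r / 2" using \<mu>_pos[of r] by (simp add: d_def)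
      ultimately show ?thesis using mult_left_mono by (metis mult.assoc)
    qed
    finally have "d r \<le> d r / 2" using \<mu>_pos[of r] by (simp add: d_def pos_divide_le_eq)
    then show ?thesis by simp
  qed
  then have "d T \<le> 0" using max[of T] \<open>-\<tau> \<le> T\<close> by auto
  then show ?thesis using \<mu>_pos[of T] by (auto simp: d_def divide_le_0_iff)
qed

definition picard :: "(real \<Rightarrow> 'z) \<Rightarrow> real \<Rightarrow> 'z" where
  "picard u t = (if t \<le> 0 then \<phi> t else S t (\<phi> 0) + integral {0..t} (\<lambda>s. S (t - s) (rhs u s)))"

lemma picard_nonneg:
  "0 \<le> t \<Longrightarrow> picard u t = S t (\<phi> 0) + integral {0..t} (\<lambda>s. S (t - s) (rhs u s))"
  by (auto simp: picard_def S_zero)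

lemma continuous_on_picard:
  assumes "continuous_on UNIV u"
  shows "continuous_on UNIV (picard u)"
proof -
  have "continuous_on {0..} (\<lambda>t. S t (\<phi> 0) + integral {0..t} (\<lambda>s. S (t - s) (rhs u s)))"
    using assms
    by (intro continuous_on_add continuous_on_S duhamel_integrable_continuous(2) continuous_intros)
      (auto intro: continuous_on_subset)
  then have "continuous_on {0..} (picard u)"
    by (subst continuous_on_cong[OF refl picard_nonneg]) auto
  moreover have "continuous_on {..0} (picard u)"
    using \<phi>_continuous by (subst continuous_on_cong[where g = \<phi>]) (auto simp: picard_def)
  ultimately have "continuous_on ({..0} \<union> {0..}) (picard u)"
    by (intro continuous_on_closed_Un) auto
  moreover have "{..0} \<union> {0..} = (UNIV :: real set)" by auto
  ultimately show ?thesis by simp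
qed

text \<open>Banach's fixed point theorem for the Picard map, globally in time. The functions \<open>u\<close> with
  \<open>norm (u t) \<le> c exp (growth t - \<omega> t)\<close> are mapped into themselves because the history fits under
  the constant \<open>c\<close> and the response adds at most \<open>c (exp (growth t) - 1) exp (- \<omega> t)\<close>. In the ball
  of radius \<open>R\<close>, where these functions take their values from time \<open>-\<tau>\<close> on, \<open>\<eta>\<close> is a Lipschitz constant, and the
  Picard map halves distances in the norm with weight \<open>exp (2 growth - \<omega> t)\<close>.\<close>

lemma mild_solution_exists:
  assumes \<eta>: "0 \<le> \<eta>" and lip: "\<And>x y. norm x \<le> R \<Longrightarrow> norm y \<le> R \<Longrightarrow>
      norm (N1 x - N1 y) \<le> \<eta> * norm (x - y) \<and> norm (N2 x - N2 y) \<le> \<eta> * norm (x - y)"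
    and c: "0 \<le> c" "\<And>t. t \<le> 0 \<Longrightarrow> norm (\<phi> t) \<le> c" "M * norm (\<phi> 0) \<le> c"
    and small: "\<And>t. -\<tau> \<le> t \<Longrightarrow> c * exp (growth \<eta> t - \<omega> * t) \<le> R"
  obtains u where "mild_solution u"
    and "\<And>t. -\<tau> \<le> t \<Longrightarrow> norm (u t) \<le> c * exp (growth \<eta> t - \<omega> * t)"
proof -
  define m where "m t = exp (growth \<eta> t - \<omega> * t)" for t
  define w where "w t = exp (2 * growth \<eta> t - \<omega> * t)" for t
  have w_cont: "continuous_on A w" for A
    unfolding w_def by (intro continuous_intros continuous_on_growth)
  have w_pos: "0 < w t" for t by (simp add: w_def)
  have m_le_w: "m t \<le> w t" for t using growth_nonneg[OF \<eta>, of t] by (simp add: m_def w_def)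
  have \<phi>_bound: "norm (\<phi> t) \<le> c * m t" if "t \<le> 0" for t
  proof -
    have "1 \<le> m t"
      using growth_nonneg[OF \<eta>, of t] that \<omega>_pos mult_nonneg_nonpos[of \<omega> t] by (simp add: m_def)
    then have "c * 1 \<le> c * m t" using c(1) by (intro mult_left_mono) auto
    then show ?thesis using c(2)[OF that] by simp
  qed
  have picard_bound: "norm (picard u t) \<le> c * m t"
    if u: "continuous_on UNIV u" "\<And>t. norm (u t) \<le> c * m t" for u t
  proof (cases "t \<le> 0")
    case True
    then show ?thesis using \<phi>_bound by (simp add: picard_def)
  next
    case False
    have uR: "norm (u s) \<le> R" if "-\<tau> \<le> s" for s
      using u(2)[of s] small[OF that] by (simp add: m_def)
    have "(\<lambda>s. S (t - s) (rhs u s)) integrable_on {0..t}"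
      using u by (intro duhamel_integrable_continuous(1)) (auto intro: continuous_on_subset)
    then have "norm (integral {0..t} (\<lambda>s. S (t - s) (rhs u s))) \<le>
        c / 1 * exp (- \<omega> * t) * (exp (1 * growth \<eta> t) - 1)"
    proof (rule duhamel_bound[OF integrable_integral, of _ _ \<eta>])
      fix s assume s: "s \<in> {0..t}"
      have rhs0: "rhs (\<lambda>_. 0) s = 0"
        by (simp add: rhs_def N_zero linear_0[OF bounded_linear.linear[OF bounded_linear_D]])
      have "norm (rhs u s - rhs (\<lambda>_. 0) s) \<le> c * ((b * \<bar>\<alpha> s\<bar> + \<eta>) * m (s - \<tau>) + \<eta> * m s)"
        using u(2)[of s] u(2)[of "s - \<tau>"] uR[of s] uR[of "s - \<tau>"] s \<tau>_pos \<eta>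
          order_trans[OF norm_ge_zero uR[of s]]
        by (intro rhs_diff_bound[where R = R])
          (auto intro: lip[THEN conjunct1] lip[THEN conjunct2])
      then show "norm (rhs u s) \<le> c * ((b * \<bar>\<alpha> s\<bar> + \<eta>) * exp (1 * growth \<eta> (s - \<tau>) - \<omega> * (s - \<tau>))
          + \<eta> * exp (1 * growth \<eta> s - \<omega> * s))"
        by (simp add: rhs0 m_def)
    qed (use False \<eta> c in auto)
    moreover have "norm (S t (\<phi> 0)) \<le> c * exp (- \<omega> * t)"
    proof -
      have "norm (S t (\<phi> 0)) \<le> (M * norm (\<phi> 0)) * exp (- \<omega> * t)"
        using S_bound[of t "\<phi> 0"] False by (simp add: algebra_simps)
      also have "\<dots> \<le> c * exp (- \<omega> * t)" using c(3) by (intro mult_right_mono) auto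
      finally show ?thesis .
    qed
    ultimately have "norm (picard u t) \<le> c * exp (- \<omega> * t) + c / 1 * exp (- \<omega> * t) * (exp (1 * growth \<eta> t) - 1)"
      using False by (simp only: picard_def if_False) (rule norm_triangle_mono)
    also have "\<dots> = c * m t" by (simp add: m_def exp_diff exp_minus field_simps)
    finally show ?thesis .
  qed
  have picard_contract: "norm (picard u t - picard v t) \<le> e / 2 * w t"
    if u: "continuous_on UNIV u" "\<And>t. norm (u t) \<le> c * m t"
      and v: "continuous_on UNIV v" "\<And>t. norm (v t) \<le> c * m t"
      and e: "0 \<le> e" "\<And>t. norm (u t - v t) \<le> e * w t" for u v t e
  proof (cases "t \<le> 0")
    case True
    then show ?thesis using e(1) w_pos[of t] by (simp add: picard_def)
  next
    case False
    have R: "norm (u s) \<le> R" "norm (v s) \<le> R" if "-\<tau> \<le> s" for s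
      using u(2)[of s] v(2)[of s] small[OF that] by (auto simp: m_def)
    have "(\<lambda>s. S (t - s) (rhs u s)) integrable_on {0..t}" "(\<lambda>s. S (t - s) (rhs v s)) integrable_on {0..t}"
      using u v by (auto intro!: duhamel_integrable_continuous(1) intro: continuous_on_subset)
    then have "((\<lambda>s. S (t - s) (rhs u s) - S (t - s) (rhs v s)) has_integral (picard u t - picard v t)) {0..t}"
      using False by (simp add: picard_def has_integral_diff integrable_integral)
    then have "((\<lambda>s. S (t - s) (rhs u s - rhs v s)) has_integral (picard u t - picard v t)) {0..t}"
      by (subst has_integral_cong[where g = "\<lambda>s. S (t - s) (rhs u s) - S (t - s) (rhs v s)"])
        (auto simp: S_diff)
    then have "norm (picard u t - picard v t) \<le> e / 2 * exp (- \<omega> * t) * (exp (2 * growth \<eta> t) - 1)"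
    proof (rule duhamel_bound[of _ _ _ \<eta>])
      fix s assume s: "s \<in> {0..t}"
      show "norm (rhs u s - rhs v s) \<le> e * ((b * \<bar>\<alpha> s\<bar> + \<eta>) * exp (2 * growth \<eta> (s - \<tau>) - \<omega> * (s - \<tau>))
          + \<eta> * exp (2 * growth \<eta> s - \<omega> * s))"
        using e(2)[of s] e(2)[of "s - \<tau>"] R[of s] R[of "s - \<tau>"] s \<tau>_pos \<eta> unfolding w_def
        by (intro rhs_diff_bound[OF lip]) auto
    qed (use False \<eta> e in auto)
    also have "\<dots> \<le> e / 2 * w t"
    proof -
      have "exp (- \<omega> * t) * (exp (2 * growth \<eta> t) - 1) \<le> w t"
        by (simp add: w_def exp_diff exp_minus field_simps)
      then have "e / 2 * (exp (- \<omega> * t) * (exp (2 * growth \<eta> t) - 1)) \<le> e / 2 * w t"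
        using e(1) by (intro mult_left_mono) auto
      then show ?thesis by (simp only: mult.assoc)
    qed
    finally show ?thesis .
  qed
  \<comment> \<open>Bounded continuous functions \<open>y\<close> with the supremum distance represent \<open>u = w y\<close>, so that the
    weight is absorbed into the representation.\<close>
  define X :: "(real, 'z) bcontfun set" where "X = {y. \<forall>t. norm (w t *\<^sub>R apply_bcontfun y t) \<le> c * m t}"
  define lift :: "(real, 'z) bcontfun \<Rightarrow> real \<Rightarrow> 'z" where "lift y t = w t *\<^sub>R apply_bcontfun y t" for y t
  define F where "F y = Bcontfun (\<lambda>t. (1 / w t) *\<^sub>R picard (lift y) t)" for y
  have lift_cont: "continuous_on UNIV (lift y)" for y
    unfolding lift_def by (intro continuous_intros w_cont) auto
  have lift_bound: "norm (lift y t) \<le> c * m t" if "y \<in> X" for y t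
    using that by (simp add: X_def lift_def)
  have F_apply: "apply_bcontfun (F y) t = (1 / w t) *\<^sub>R picard (lift y) t" if y: "y \<in> X" for y t
  proof -
    have "(\<lambda>t. (1 / w t) *\<^sub>R picard (lift y) t) \<in> bcontfun"
      unfolding bcontfun_def
    proof (intro CollectI conjI boundedI)
      show "continuous_on UNIV (\<lambda>t. (1 / w t) *\<^sub>R picard (lift y) t)"
        using w_pos by (intro continuous_intros w_cont continuous_on_picard lift_cont) (auto simp: less_imp_neq[symmetric])
      fix x assume "x \<in> range (\<lambda>t. (1 / w t) *\<^sub>R picard (lift y) t)"
      then obtain t where t: "x = (1 / w t) *\<^sub>R picard (lift y) t" by blast
      have "norm (picard (lift y) t) \<le> c * w t"
        using picard_bound[OF lift_cont lift_bound[OF y], of t] mult_left_mono[OF m_le_w c(1), of t] by linarith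
      then show "norm x \<le> c" using w_pos[of t] by (simp add: t field_simps)
    qed
    then show ?thesis by (simp add: F_def Bcontfun_inverse)
  qed
  have lift_F: "lift (F y) = picard (lift y)" if "y \<in> X" for y
    using w_pos by (auto simp: lift_def F_apply[OF that] less_imp_neq[symmetric])
  have "\<exists>!y\<in>X. F y = y"
  proof (rule Banach_fix[of X "1/2" F])
    have "closed {y :: (real, 'z) bcontfun. norm (w t *\<^sub>R apply_bcontfun y t) \<le> c * m t}" for t
    proof -
      have "continuous_on UNIV (\<lambda>y :: (real, 'z) bcontfun. apply_bcontfun y t)"
        unfolding continuous_on_iff using dist_bounded by (metis le_less_trans)
      then show ?thesis by (intro closed_Collect_le continuous_intros)
    qed
    moreover have "X = (\<Inter>t. {y. norm (w t *\<^sub>R apply_bcontfun y t) \<le> c * m t})" by (auto simp: X_def)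
    ultimately show "complete X" by (simp add: complete_eq_closed closed_INT)
    show "X \<noteq> {}"
    proof -
      have "const_bcontfun 0 \<in> X" using c(1) by (simp add: X_def const_bcontfun.rep_eq m_def)
      then show ?thesis by blast
    qed
    show "F ` X \<subseteq> X"
    proof
      fix z assume "z \<in> F ` X"
      then obtain y where y: "y \<in> X" "z = F y" by blast
      have "norm (lift z t) \<le> c * m t" for t
        using picard_bound[OF lift_cont lift_bound[OF y(1)]] by (simp add: y lift_F)
      then show "z \<in> X" by (simp add: X_def lift_def)
    qed
    fix x y assume xy: "x \<in> X" "y \<in> X"
    show "dist (F x) (F y) \<le> 1/2 * dist x y"
    proof (rule dist_bound)
      fix t
      have "norm (lift x s - lift y s) \<le> dist x y * w s" for s
        using dist_bounded[of x s y] w_pos[of s]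
        unfolding lift_def scaleR_diff_right[symmetric] by (simp add: dist_norm mult.commute)
      then have "norm (picard (lift x) t - picard (lift y) t) \<le> dist x y / 2 * w t"
        using xy by (intro picard_contract lift_cont lift_bound) auto
      moreover have "dist (F x t) (F y t) = norm ((1 / w t) *\<^sub>R (picard (lift x) t - picard (lift y) t))"
        by (simp only: F_apply xy dist_norm scaleR_diff_right)
      moreover have "\<dots> = norm (picard (lift x) t - picard (lift y) t) / w t"
        using w_pos[of t] by simp
      ultimately show "dist (F x t) (F y t) \<le> 1/2 * dist x y"
        using w_pos[of t] by (simp add: pos_divide_le_eq)
    qed
  qed auto
  then obtain y where y: "y \<in> X" "F y = y" by blast
  then have fixed_pt: "picard (lift y) = lift y" using lift_F by metis
  show ?thesis
  proof (rule that[of "lift y"])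
    show "mild_solution (lift y)" unfolding mild_solution_def
    proof (intro conjI ballI allI impI)
      show "continuous_on {-\<tau>..} (lift y)" by (rule continuous_on_subset[OF lift_cont]) simp
      show "lift y t = \<phi> t" if "t \<in> {-\<tau>..0}" for t
        using that by (subst fixed_pt[symmetric]) (simp add: picard_def)
      fix t :: real assume "0 \<le> t"
      have "(\<lambda>s. S (t - s) (rhs (lift y) s)) integrable_on {0..t}"
        by (intro duhamel_integrable_continuous(1) continuous_on_subset[OF lift_cont]) simp
      moreover have "lift y t = S t (\<phi> 0) + integral {0..t} (\<lambda>s. S (t - s) (rhs (lift y) s))"
        using picard_nonneg[OF \<open>0 \<le> t\<close>, of "lift y"] fixed_pt by simp
      moreover have "lift y 0 = \<phi> 0" by (subst fixed_pt[symmetric]) (simp add: picard_def)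
      ultimately show "((\<lambda>s. S (t - s) (rhs (lift y) s)) has_integral (lift y t - S t (lift y 0))) {0..t}"
        by (simp add: has_integral_integral)
    qed
    show "norm (lift y t) \<le> c * exp (growth \<eta> t - \<omega> * t)" for t
      using lift_bound[OF y(1)] by (simp add: m_def)
  qed
qed

end

section \<open>The wave equation in the energy space\<close>

text \<open>In the coordinates \<open>(rA u, v)\<close> the energy space is the full product space with its own norm, and
  the semigroup becomes a strongly continuous semigroup on that space. The
  second claim is \<open>u\<^sub>t = v\<close> along free orbits, integrated: the time integral of an orbit lies in the
  domain of the generator, and the first component of the wave operator is the velocity.\<close>

lemma transported_semigroup:
  fixes DV :: "'a::{real_inner, banach} set"
  assumes sq: "is_sqrt_operator DV rA DA A"
    and T: "bounded_linear T" "\<And>x. T x \<in> DV" "\<And>x. rA (T x) = x" "\<And>u. u \<in> DV \<Longrightarrow> T (rA u) = u"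
    and gen: "generates_energy_semigroup DV rA (wave_domain DA DV) (wave_operator A C) S"
    and pos: "M > 0" "\<omega> > 0"
    and stability: "\<And>t U. t \<ge> 0 \<Longrightarrow> U \<in> energy_space DV \<Longrightarrow>
          energy_norm rA (S t U) \<le> M * exp (- \<omega> * t) * energy_norm rA U"
  defines "\<Sigma> \<equiv> \<lambda>t z. energy_emb rA (S t (T (fst z), snd z))"
  shows "stable_semigroup \<Sigma> M \<omega>"
    and "\<And>t z. 0 \<le> t \<Longrightarrow> T (fst (\<Sigma> t z)) - T (fst z) = integral {0..t} (\<lambda>s. snd (\<Sigma> s z))"
proof -
  note rA = is_sqrt_operatorD[OF sq]
  define lift where "lift z = (T (fst z), snd z)" for z :: "'a \<times> 'a"
  have T_add: "T (x + y) = T x + T y" and T_scale: "T (r *\<^sub>R x) = r *\<^sub>R T x" for x y r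
    using linear_add[OF bounded_linear.linear[OF T(1)]] linear_scale[OF bounded_linear.linear[OF T(1)]] by auto
  have lift_mem: "lift z \<in> energy_space DV" for z by (simp add: lift_def energy_space_def T)
  have emb_lift: "energy_emb rA (lift z) = z" for z by (simp add: lift_def energy_emb_def T)
  have lift_emb: "lift (energy_emb rA U) = U" if "U \<in> energy_space DV" for U
    using that by (auto simp: lift_def energy_emb_def energy_space_def T)
  have lift_add: "lift (x + y) = lift x + lift y" and lift_scale: "lift (r *\<^sub>R x) = r *\<^sub>R lift x" for x y r
    by (simp_all add: lift_def T_add T_scale)
  have emb_add: "energy_emb rA (U + V) = energy_emb rA U + energy_emb rA V"
    and emb_diff: "energy_emb rA (U - V) = energy_emb rA U - energy_emb rA V"
    if "U \<in> energy_space DV" "V \<in> energy_space DV" for U V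
    using that by (auto simp: energy_emb_def energy_space_def rA(7,8))
  have emb_scale: "energy_emb rA (r *\<^sub>R U) = r *\<^sub>R energy_emb rA U" if "U \<in> energy_space DV" for U r
    using that by (auto simp: energy_emb_def energy_space_def rA(9))
  have E_diff: "U - V \<in> energy_space DV" if "U \<in> energy_space DV" "V \<in> energy_space DV" for U V
    using that subspace_diff[OF rA(1)] by (auto simp: energy_space_def)
  have C0: "energy_C0_semigroup DV rA S" using gen by (simp add: generates_energy_semigroup_def)
  have S_lin: "linear_operator (energy_space DV) (S t)"
    and S_mem: "U \<in> energy_space DV \<Longrightarrow> S t U \<in> energy_space DV" if "0 \<le> t" for t U
    using C0 that by (auto simp: energy_C0_semigroup_def)
  have S_sg: "U \<in> energy_space DV \<Longrightarrow> S 0 U = U"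
    "U \<in> energy_space DV \<Longrightarrow> 0 \<le> s \<Longrightarrow> 0 \<le> t \<Longrightarrow> S (s + t) U = S s (S t U)"
    "U \<in> energy_space DV \<Longrightarrow> ((\<lambda>t. energy_emb rA (S t U)) \<longlongrightarrow> energy_emb rA U) (at_right 0)" for U s t
    using C0 by (auto simp: energy_C0_semigroup_def)
  have \<Sigma>: "\<Sigma> t z = energy_emb rA (S t (lift z))" for t z by (simp add: \<Sigma>_def lift_def)
  have bound: "norm (\<Sigma> t z) \<le> M * exp (- \<omega> * t) * norm z" if "0 \<le> t" for t z
    using stability[OF that lift_mem[of z]] by (simp add: \<Sigma> norm_energy_emb[symmetric] emb_lift)
  show sg: "stable_semigroup \<Sigma> M \<omega>"
  proof (rule stable_semigroup.intro)
    fix t :: real assume t: "0 \<le> t"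
    show "bounded_linear (\<Sigma> t)"
    proof (rule bounded_linear_intro[where K = "M * exp (- \<omega> * t)"])
      show "\<Sigma> t (x + y) = \<Sigma> t x + \<Sigma> t y" for x y
        using S_lin[OF t] lift_mem S_mem[OF t] by (simp add: \<Sigma> lift_add linear_operator_def emb_add)
      show "\<Sigma> t (r *\<^sub>R x) = r *\<^sub>R \<Sigma> t x" for r x
        using S_lin[OF t] lift_mem S_mem[OF t] by (simp add: \<Sigma> lift_scale linear_operator_def emb_scale)
      show "norm (\<Sigma> t x) \<le> norm x * (M * exp (- \<omega> * t))" for x
        using bound[OF t, of x] by (simp add: mult.commute)
    qed
    show "norm (\<Sigma> t x) \<le> M * exp (- \<omega> * t) * norm x" for x by (rule bound[OF t])
    show "\<Sigma> (s + t) x = \<Sigma> s (\<Sigma> t x)" if "0 \<le> s" for s x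
      using S_sg(2)[OF lift_mem that t] S_mem[OF t lift_mem] by (simp add: \<Sigma> lift_emb)
  next
    show "\<Sigma> 0 x = x" for x by (simp add: \<Sigma> S_sg(1) lift_mem emb_lift)
    show "((\<lambda>t. \<Sigma> t x) \<longlongrightarrow> x) (at_right 0)" for x
      using S_sg(3)[OF lift_mem[of x]] by (simp add: \<Sigma> emb_lift)
  qed (use pos in auto)
  interpret stable_semigroup \<Sigma> M \<omega> by (rule sg)
  show "T (fst (\<Sigma> t z)) - T (fst z) = integral {0..t} (\<lambda>s. snd (\<Sigma> s z))" if t: "0 \<le> t" for t z
  proof -
    define V where "V = integral {0..t} (\<lambda>s. \<Sigma> s z)"
    have "((\<lambda>h. (1 / h) *\<^sub>R (\<Sigma> h V - V)) \<longlongrightarrow> \<Sigma> t z - z) (at_right 0)"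
      unfolding V_def by (rule orbit_integral_generator[OF t])
    moreover have "eventually (\<lambda>h. (1 / h) *\<^sub>R (\<Sigma> h V - V)
        = energy_emb rA ((1 / h) *\<^sub>R (S h (lift V) - lift V))) (at_right 0)"
      unfolding eventually_at_right_field
      using S_mem lift_mem by (intro exI[of _ 1]) (simp add: emb_scale emb_diff E_diff \<Sigma> emb_lift)
    ultimately have "((\<lambda>h. energy_emb rA ((1 / h) *\<^sub>R (S h (lift V) - lift V)))
        \<longlongrightarrow> energy_emb rA (lift (\<Sigma> t z - z))) (at_right 0)"
      by (simp add: emb_lift tendsto_cong)
    then have "lift (\<Sigma> t z - z) = wave_operator A C (lift V)"
      using gen lift_mem unfolding generates_energy_semigroup_def by blast
    then have "T (fst (\<Sigma> t z - z)) = snd V"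
      by (simp add: lift_def wave_operator_def)
    moreover have "(\<lambda>s. \<Sigma> s z) integrable_on {0..t}"
      by (intro integrable_continuous_real continuous_on_S continuous_intros) auto
    then have "integral {0..t} (snd \<circ> (\<lambda>s. \<Sigma> s z)) = snd V"
      unfolding V_def by (intro integral_linear bounded_linear_snd)
    ultimately show ?thesis
      by (simp add: o_def linear_diff[OF bounded_linear.linear[OF T(1)]])
  qed
qed

text \<open>Each term of the energy is bounded by a multiple of the square of the energy norm, taken at time
  \<open>t\<close> or in the window \<open>{t - \<tau>..t}\<close>, where the bound \<open>decay\<close> exceeds its value at \<open>t\<close>, after squaring, at most by the fixed factor
  \<open>exp (2 \<delta> \<tau>)\<close>: the potential through its growth bound, the gradient of \<open>\<psi>2\<close> through its Lipschitz
  constant on the ball of radius \<open>R1\<close> that contains the trajectory, and the delay term through the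
  bound \<open>\<sigma>\<close> for \<open>\<alpha>\<close> over a window of length \<open>\<tau>\<close>.\<close>

lemma delay_energy_decay:
  fixes DV :: "'a::{real_inner, banach} set"
  assumes sq: "is_sqrt_operator DV rA DA A" and B: "bounded_linear B" and "\<tau> > 0" "\<delta> > 0" "R > 0"
    and \<alpha>: "\<And>t. (\<lambda>s. \<bar>\<alpha> s\<bar>) integrable_on {0..t}"
    and \<alpha>_\<sigma>: "\<And>t. t \<ge> 0 \<Longrightarrow> integral {t - \<tau>..t} (\<lambda>s. \<bar>\<alpha> s\<bar>) \<le> \<sigma>"
    and \<psi>1: "bounded_gateaux DV \<psi>1" "\<psi>1 0 = 0"
    and h: "strict_mono_on {0..} h"
    and grad: "\<And>u. u \<in> DV \<Longrightarrow> \<bar>gradient_on DV \<psi>1 u \<bullet> u\<bar> \<le> h (norm (rA u)) * (norm (rA u))\<^sup>2"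
    and \<psi>2: "gradient_lipschitz_with DV rA L \<psi>2" "gradient_on DV \<psi>2 0 = 0" and L: "\<And>r. r > 0 \<Longrightarrow> L r > 0"
    and U: "\<And>t. -\<tau> \<le> t \<Longrightarrow> U t \<in> energy_space DV"
    and decay: "\<And>t. -\<tau> \<le> t \<Longrightarrow> energy_norm rA (U t) \<le> R * exp (- \<delta> * t)"
  shows "\<exists>Ctilde. \<forall>t\<ge>0. delay_energy DV rA B \<psi>1 \<psi>2 \<alpha> \<tau> U t \<le> Ctilde * exp (- (2 * \<delta>) * t)"
proof -
  note rA = is_sqrt_operatorD[OF sq]
  obtain q where q: "q > 0" "\<And>x. norm (adjoint B x) \<le> norm x * q"
    using bounded_linear.pos_bounded[OF adjoint_hilbert(2)[OF B]] by auto
  define H where "H = \<bar>h 0\<bar> + \<bar>h R\<bar>"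
  define R1 where "R1 = R * exp (\<delta> * \<tau>)"
  define G where "G = R\<^sup>2 * exp (2 * \<delta> * \<tau>)"
  have "R1 > 0" using \<open>R > 0\<close> by (simp add: R1_def)
  define Ct where "Ct = (1/2 + H) * R\<^sup>2 + 1/2 * (\<tau> * ((L R1)\<^sup>2 * G)) + 1/2 * (\<sigma> * (q\<^sup>2 * G))"
  have parts: "(energy_norm rA (U t))\<^sup>2 = (norm (snd (U t)))\<^sup>2 + (norm (rA (fst (U t))))\<^sup>2" for t
    by (simp add: energy_norm_def energy_inner_def power2_norm_eq_inner)
  have sq_decay: "(energy_norm rA (U t))\<^sup>2 \<le> R\<^sup>2 * exp (- (2 * \<delta>) * t)" if "-\<tau> \<le> t" for t
  proof -
    have "(energy_norm rA (U t))\<^sup>2 \<le> R\<^sup>2 * (exp (- \<delta> * t))\<^sup>2"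
      unfolding power_mult_distrib[symmetric] using decay[OF that] by (intro power_mono) (auto simp: norm_energy_emb[symmetric])
    also have "(exp (- \<delta> * t))\<^sup>2 = exp (- (2 * \<delta>) * t)"
      by (simp add: exp_double[symmetric] algebra_simps)
    finally show ?thesis by (simp add: power_mult_distrib)
  qed
  have "delay_energy DV rA B \<psi>1 \<psi>2 \<alpha> \<tau> U t \<le> Ct * exp (- (2 * \<delta>) * t)" if t: "0 \<le> t" for t
  proof -
    define e where "e = exp (- (2 * \<delta>) * t)"
    define r where "r = norm (rA (fst (U t)))"
    have mem: "fst (U s) \<in> DV" if "-\<tau> \<le> s" for s using U[OF that] by (auto simp: energy_space_def)
    have now: "(norm (snd (U t)))\<^sup>2 + r\<^sup>2 \<le> R\<^sup>2 * e"
      using sq_decay[of t] t \<open>\<tau> > 0\<close> by (simp add: parts r_def e_def)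
    have past: "(norm (snd (U s)))\<^sup>2 + (norm (rA (fst (U s))))\<^sup>2 \<le> G * e" if s: "s \<in> {t - \<tau>..t}" for s
    proof -
      have "\<delta> * t \<le> \<delta> * (s + \<tau>)" using s \<open>\<delta> > 0\<close> by (intro mult_left_mono) auto
      then have "exp (- (2 * \<delta>) * s) \<le> exp (2 * \<delta> * \<tau> + - (2 * \<delta>) * t)"
        by (simp add: algebra_simps)
      then have "R\<^sup>2 * exp (- (2 * \<delta>) * s) \<le> G * e"
        unfolding G_def e_def exp_add mult.assoc by (intro mult_left_mono) auto
      then show ?thesis using sq_decay[of s] s t by (simp add: parts)
    qed
    have "\<bar>\<psi>1 (fst (U t))\<bar> \<le> \<bar>h r\<bar> * r\<^sup>2"
      unfolding r_def using t \<open>\<tau> > 0\<close> by (intro potential_bound[OF sq \<psi>1 h grad] mem) auto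
    also have "\<dots> \<le> H * (R\<^sup>2 * e)"
    proof (intro mult_mono)
      have "r\<^sup>2 \<le> R\<^sup>2 * e" using now zero_le_power2[of "norm (snd (U t))"] by linarith
      also have "R\<^sup>2 * e \<le> R\<^sup>2" using t \<open>\<delta> > 0\<close> by (simp add: e_def mult_left_le)
      finally have "r \<le> R" using \<open>R > 0\<close> by (auto intro: power2_le_imp_le)
      then have "h 0 \<le> h r" "h r \<le> h R"
        by (auto intro!: strict_mono_on_leD[OF h] simp: r_def less_imp_le[OF \<open>R > 0\<close>])
      then show "\<bar>h r\<bar> \<le> H" by (simp add: H_def)
      show "r\<^sup>2 \<le> R\<^sup>2 * e" by fact
    qed (auto simp: H_def)
    finally have psi: "- \<psi>1 (fst (U t)) \<le> H * (R\<^sup>2 * e)" by linarith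
    have "integral {t - \<tau>..t} (\<lambda>s. (norm (gradient_on DV \<psi>2 (fst (U s))))\<^sup>2)
        \<le> integral {t - \<tau>..t} (\<lambda>s. (L R1)\<^sup>2 * (G * e))"
    proof (rule integral_le_nonneg_bound)
      fix s assume s: "s \<in> {t - \<tau>..t}"
      then have s': "-\<tau> \<le> s" using t by auto
      have "(norm (rA (fst (U s))))\<^sup>2 \<le> (energy_norm rA (U s))\<^sup>2" by (simp add: parts)
      then have "norm (rA (fst (U s))) \<le> energy_norm rA (U s)"
        by (rule power2_le_imp_le) (simp add: norm_energy_emb[symmetric])
      also have "\<dots> \<le> R1"
      proof -
        have "- \<delta> * s \<le> \<delta> * \<tau>" using s' \<open>\<delta> > 0\<close> mult_left_mono[of "- s" \<tau> \<delta>] by simp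
        then have "R * exp (- \<delta> * s) \<le> R1" unfolding R1_def using \<open>R > 0\<close> by (intro mult_left_mono) auto
        then show ?thesis using decay[OF s'] by linarith
      qed
      finally have "norm (gradient_on DV \<psi>2 (fst (U s)) - gradient_on DV \<psi>2 0) \<le> L R1 * norm (rA (fst (U s) - 0))"
        using \<psi>2(1) \<open>R1 > 0\<close> mem[OF s'] subspace_0[OF rA(1)] rA(8)[of 0 0]
        unfolding gradient_lipschitz_with_def by (metis diff_self norm_zero less_imp_le)
      then have "(norm (gradient_on DV \<psi>2 (fst (U s))))\<^sup>2 \<le> (L R1 * norm (rA (fst (U s))))\<^sup>2"
        by (intro power_mono) (auto simp: \<psi>2(2))
      also have "\<dots> \<le> (L R1)\<^sup>2 * (G * e)"
        using past[OF s] zero_le_power2[of "norm (snd (U s))"]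
        unfolding power_mult_distrib by (intro mult_left_mono zero_le_power2) linarith
      finally show "(norm (gradient_on DV \<psi>2 (fst (U s))))\<^sup>2 \<le> (L R1)\<^sup>2 * (G * e)" .
    qed (auto simp: G_def e_def)
    then have grad2: "integral {t - \<tau>..t} (\<lambda>s. (norm (gradient_on DV \<psi>2 (fst (U s))))\<^sup>2) \<le> \<tau> * ((L R1)\<^sup>2 * (G * e))"
      using \<open>\<tau> > 0\<close> by (simp add: mult_ac)
    have \<alpha>_shift: "((\<lambda>s. \<bar>\<alpha> (s + \<tau>)\<bar>) has_integral integral {t..t + \<tau>} (\<lambda>s. \<bar>\<alpha> s\<bar>)) {t - \<tau>..t}"
    proof -
      have "(\<lambda>s. \<bar>\<alpha> s\<bar>) integrable_on {t..t + \<tau>}"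
        using t by (intro integrable_subinterval_real[OF \<alpha>[of "t + \<tau>"]]) auto
      from has_integral_shift_real_ivl[OF integrable_integral[OF this], of \<tau>] show ?thesis by simp
    qed
    have "integral {t - \<tau>..t} (\<lambda>s. \<bar>\<alpha> (s + \<tau>)\<bar> * (norm (adjoint B (snd (U s))))\<^sup>2)
        \<le> integral {t - \<tau>..t} (\<lambda>s. \<bar>\<alpha> (s + \<tau>)\<bar> * (q\<^sup>2 * (G * e)))"
    proof (rule integral_le_nonneg_bound)
      show "(\<lambda>s. \<bar>\<alpha> (s + \<tau>)\<bar> * (q\<^sup>2 * (G * e))) integrable_on {t - \<tau>..t}"
        using \<alpha>_shift by (intro integrable_on_mult_left) auto
      fix s assume s: "s \<in> {t - \<tau>..t}"
      have "(norm (adjoint B (snd (U s))))\<^sup>2 \<le> (norm (snd (U s)) * q)\<^sup>2" by (intro power_mono q) auto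
      also have "\<dots> = q\<^sup>2 * (norm (snd (U s)))\<^sup>2" by (simp add: power_mult_distrib)
      also have "\<dots> \<le> q\<^sup>2 * (G * e)"
        using past[OF s] zero_le_power2[of "norm (rA (fst (U s)))"]
        by (intro mult_left_mono zero_le_power2) linarith
      finally show "\<bar>\<alpha> (s + \<tau>)\<bar> * (norm (adjoint B (snd (U s))))\<^sup>2 \<le> \<bar>\<alpha> (s + \<tau>)\<bar> * (q\<^sup>2 * (G * e))"
        by (intro mult_left_mono) auto
    qed (auto simp: G_def e_def)
    also have "\<dots> = integral {t..t + \<tau>} (\<lambda>s. \<bar>\<alpha> s\<bar>) * (q\<^sup>2 * (G * e))"
      using \<alpha>_shift by (simp add: integral_unique)
    also have "\<dots> \<le> \<sigma> * (q\<^sup>2 * (G * e))"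
      using \<alpha>_\<sigma>[of "t + \<tau>"] t \<open>\<tau> > 0\<close> by (intro mult_right_mono) (auto simp: G_def e_def)
    finally have delay: "integral {t - \<tau>..t} (\<lambda>s. \<bar>\<alpha> (s + \<tau>)\<bar> * (norm (adjoint B (snd (U s))))\<^sup>2)
        \<le> \<sigma> * (q\<^sup>2 * (G * e))" .
    have "Ct * e = 1/2 * (R\<^sup>2 * e) + H * (R\<^sup>2 * e) + 1/2 * (\<tau> * ((L R1)\<^sup>2 * (G * e))) + 1/2 * (\<sigma> * (q\<^sup>2 * (G * e)))"
      by (simp add: Ct_def algebra_simps)
    then show ?thesis
      using now psi grad2 delay unfolding delay_energy_def e_def[symmetric] r_def[symmetric] by linarith
  qed
  then show ?thesis by blast
qed

section \<open>Well-posedness and exponential decay\<close>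

theorem theorem2p7:
  fixes DA DV :: "'a::{real_inner, banach} set"
    and A rA :: "'a \<Rightarrow> 'a"
    and C :: "'w::{real_inner, banach} \<Rightarrow> 'a"
    and B :: "'a \<Rightarrow> 'a"
    and S :: "real \<Rightarrow> 'a \<times> 'a \<Rightarrow> 'a \<times> 'a"
    and \<psi>1 \<psi>2 :: "'a \<Rightarrow> real"
    and \<alpha> L h1 :: "real \<Rightarrow> real"
    and \<tau> \<sigma> T0 c M \<omega> b \<gamma> \<omega>' :: real
  assumes A: "positive_selfadjoint DA A"
    and sqrt_A: "is_sqrt_operator DV rA DA A"
    and energy_complete: "complete (energy_emb rA ` energy_space DV)"
    and B: "bounded_linear B"
    and C: "bounded_linear C"
    and tau: "\<tau> > 0"
    and alpha_loc: "\<And>t. t \<ge> 0 \<Longrightarrow> \<alpha> absolutely_integrable_on {0..t}"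
    and alpha_neg: "\<And>t. t < 0 \<Longrightarrow> \<alpha> t = 0"
    and sigma: "\<sigma> > 0"
    and alpha_sigma: "\<And>t. t \<ge> 0 \<Longrightarrow> integral {t - \<tau>..t} (\<lambda>s. \<bar>\<alpha> s\<bar>) \<le> \<sigma>"
    and semigroup: "generates_energy_semigroup DV rA (wave_domain DA DV) (wave_operator A C) S"
    and observability_const: "T0 > 0" "c > 0"
    and observability: "observability DV rA C S T0 c"
    and stability_const: "M > 0" "\<omega> > 0"
    and stability: "\<And>t U. t \<ge> 0 \<Longrightarrow> U \<in> energy_space DV \<Longrightarrow>
          energy_norm rA (S t U) \<le> M * exp (- \<omega> * t) * energy_norm rA U"
    and gateaux: "bounded_gateaux DV \<psi>1" "bounded_gateaux DV \<psi>2"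
    and L_pos: "\<And>R. R > 0 \<Longrightarrow> L R > 0"
    and lipschitz: "gradient_lipschitz_with DV rA L \<psi>1" "gradient_lipschitz_with DV rA L \<psi>2"
    and L_limit: "(L \<longlongrightarrow> 0) (at_right 0)"
    and psi_zero: "\<psi>1 0 = 0" "\<psi>2 0 = 0"
    and grad_zero: "gradient_on DV \<psi>1 0 = 0" "gradient_on DV \<psi>2 0 = 0"
    and h1: "strict_mono_on {0..} h1" "continuous_on {0..} h1"
    and grad_h1: "\<And>u. u \<in> DV \<Longrightarrow>
          \<bar>gradient_on DV \<psi>1 u \<bullet> u\<bar> \<le> h1 (norm (rA u)) * (norm (rA u))\<^sup>2"
    and b: "b = onorm (\<lambda>x. B (adjoint B x))"
    and gamma: "\<gamma> \<ge> 0"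
    and omega': "0 \<le> \<omega>'" "\<omega>' < \<omega>"
    and alpha_growth: "\<And>t. t > 0 \<Longrightarrow>
          M * b * exp (\<omega> * \<tau>) * integral {0..t} (\<lambda>s. \<bar>\<alpha> (s + \<tau>)\<bar>) \<le> \<gamma> + \<omega>' * t"
  shows "\<exists>\<rho>>0. \<forall>f0 g0.
     energy_continuous_on DV rA {-\<tau>..0} (\<lambda>s. (f0 s, g0 s)) \<longrightarrow>
     (norm (g0 0))\<^sup>2 + (norm (rA (f0 0)))\<^sup>2
       + integral {-\<tau>..0} (\<lambda>s. (norm (gradient_on DV \<psi>2 (f0 s)))\<^sup>2)
       + integral {-\<tau>..0} (\<lambda>s. \<bar>\<alpha> (s + \<tau>)\<bar> * (norm (adjoint B (g0 s)))\<^sup>2) < \<rho>\<^sup>2 \<longrightarrow>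
     (SUP s\<in>{-\<tau>..0}. energy_norm rA (f0 s, g0 s)) < \<rho> \<longrightarrow>
     (\<exists>U. is_mild_solution DV rA S B \<psi>1 \<psi>2 \<alpha> \<tau> (\<lambda>s. (f0 s, g0 s)) U \<and>
          (\<forall>V. is_mild_solution DV rA S B \<psi>1 \<psi>2 \<alpha> \<tau> (\<lambda>s. (f0 s, g0 s)) V
                \<longrightarrow> (\<forall>t\<ge>-\<tau>. V t = U t)) \<and>
          (\<exists>Ctilde. \<forall>t\<ge>0. delay_energy DV rA B \<psi>1 \<psi>2 \<alpha> \<tau> U t
                                \<le> Ctilde * exp (- (\<omega> - \<omega>') * t)))"
proof -
  note rA = is_sqrt_operatorD[OF sqrt_A]
  obtain T where T: "bounded_linear T" "\<And>x. T x \<in> DV" "\<And>x. rA (T x) = x" "\<And>u. u \<in> DV \<Longrightarrow> T (rA u) = u"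
    using sqrt_operator_inverse[OF sqrt_A energy_complete] by blast
  define emb where "emb = energy_emb rA"
  define lift where "lift z = (T (fst z), snd z)" for z :: "'a \<times> 'a"
  have emb_simps: "fst (emb U) = rA (fst U)" "snd (emb U) = snd U" for U
    by (simp_all add: emb_def energy_emb_def)
  have lift_mem: "lift z \<in> energy_space DV" for z by (simp add: lift_def energy_space_def T)
  have emb_lift: "emb (lift z) = z" for z by (simp add: emb_def lift_def energy_emb_def T)
  have lift_emb: "lift (emb U) = U" if "U \<in> energy_space DV" for U
    using that by (auto simp: emb_def lift_def energy_emb_def energy_space_def T)
  have norm_emb: "norm (emb U) = energy_norm rA U" for U by (simp add: emb_def norm_energy_emb)
  have emb_diff: "emb (U - V) = emb U - emb V" if "U \<in> energy_space DV" "V \<in> energy_space DV" for U V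
    unfolding emb_def using that by (rule energy_emb_diff[OF rA(2)])
  have E_diff: "U - V \<in> energy_space DV" if "U \<in> energy_space DV" "V \<in> energy_space DV" for U V
    using that subspace_diff[OF rA(1)] by (auto simp: energy_space_def)
  have S_mem: "S t U \<in> energy_space DV" if "0 \<le> t" "U \<in> energy_space DV" for t U
    using semigroup that by (auto simp: generates_energy_semigroup_def energy_C0_semigroup_def)
  define \<Sigma> where "\<Sigma> t z = energy_emb rA (S t (T (fst z), snd z))" for t z
  have \<Sigma>: "\<Sigma> t z = emb (S t (lift z))" for t z by (simp add: \<Sigma>_def emb_def lift_def)
  have sg: "stable_semigroup \<Sigma> M \<omega>"
    and kin: "\<And>t z. 0 \<le> t \<Longrightarrow> T (fst (\<Sigma> t z)) - T (fst z) = integral {0..t} (\<lambda>s. snd (\<Sigma> s z))"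
    unfolding \<Sigma>_def using transported_semigroup[OF sqrt_A T semigroup stability_const stability] by blast+

  define D :: "'a \<times> 'a \<Rightarrow> 'a \<times> 'a" where "D z = (0, - B (adjoint B (snd z)))" for z
  define N where "N \<psi> z = (0 :: 'a, gradient_on DV \<psi> (T (fst z)))" for \<psi> and z :: "'a \<times> 'a"
  have BB: "bounded_linear (\<lambda>x. B (adjoint B x))"
    by (rule bounded_linear_compose[OF B adjoint_hilbert(2)[OF B]])
  have D_lin: "bounded_linear D"
    unfolding D_def[abs_def]
    by (intro bounded_linear_Pair bounded_linear_zero bounded_linear_minus
        bounded_linear_compose[OF BB bounded_linear_snd])
  have D_bound: "norm (D z) \<le> b * norm z" for z
  proof -
    have "norm (D z) = norm (B (adjoint B (snd z)))" by (simp add: D_def norm_Pair)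
    also have "\<dots> \<le> b * norm (snd z)" unfolding b by (rule onorm[OF BB])
    also have "\<dots> \<le> b * norm z"
      using onorm_pos_le[OF BB] norm_snd_le[of "snd z" "fst z"] by (intro mult_left_mono) (auto simp: b)
    finally show ?thesis .
  qed
  have N_lip: "norm (N \<psi> x - N \<psi> y) \<le> L R * norm (x - y)"
    if "R > 0" "norm x \<le> R" "norm y \<le> R" "gradient_lipschitz_with DV rA L \<psi>" for R x y \<psi>
  proof -
    have "norm (N \<psi> x - N \<psi> y) = norm (gradient_on DV \<psi> (T (fst x)) - gradient_on DV \<psi> (T (fst y)))"
      by (simp add: N_def norm_Pair)
    also have "\<dots> \<le> L R * norm (rA (T (fst x) - T (fst y)))"
      using that norm_fst_le[of "fst x" "snd x"] norm_fst_le[of "fst y" "snd y"]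
      unfolding gradient_lipschitz_with_def by (auto simp: T)
    also have "\<dots> = L R * norm (fst (x - y))" using T by (simp add: rA(8))
    also have "\<dots> \<le> L R * norm (x - y)"
      using L_pos[OF that(1)] norm_fst_le[of "fst (x - y)" "snd (x - y)"]
      by (intro mult_left_mono) (simp_all only: prod.collapse less_imp_le)
    finally show ?thesis .
  qed

  \<comment> \<open>The norm needs to decay at half the rate of the energy only. The other half of
    \<open>\<omega> - \<omega>'\<close> is available to absorb the nonlinearity, which costs \<open>\<eta> * P\<close> in the growth rate.\<close>
  define \<delta> where "\<delta> = (\<omega> - \<omega>') / 2"
  have "\<delta> > 0" and two_\<delta>: "2 * \<delta> = \<omega> - \<omega>'" using omega' by (simp_all add: \<delta>_def)
  define P where "P = M * (exp (\<omega> * \<tau>) + 1)"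
  have "P > 0" using stability_const by (simp add: P_def add_pos_pos)
  obtain R where "R > 0" and LR: "L R < \<delta> / P"
  proof -
    have "eventually (\<lambda>R. L R < \<delta> / P) (at_right 0)"
      using \<open>\<delta> > 0\<close> \<open>P > 0\<close> by (intro order_tendstoD(2)[OF L_limit]) simp
    then obtain d where "d > 0" "\<And>R. 0 < R \<Longrightarrow> R < d \<Longrightarrow> L R < \<delta> / P"
      unfolding eventually_at_right_field by auto
    then show ?thesis by (intro that[of "d / 2"]) auto
  qed
  define \<eta> where "\<eta> = L R"
  have "\<eta> > 0" using L_pos[OF \<open>R > 0\<close>] by (simp add: \<eta>_def)
  have \<eta>P: "\<eta> * P \<le> \<delta>" using LR \<open>P > 0\<close> by (simp add: \<eta>_def pos_less_divide_eq less_imp_le)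
  \<comment> \<open>The growth collected over \<open>{-\<tau>..0}\<close>, together with the additive constant of the hypothesis on
    \<open>\<alpha>\<close>. The radius \<open>\<rho>\<close> is such that a solution starting from it cannot leave the ball of radius
    \<open>R\<close>. The constant \<open>M + 1\<close> dominates both \<open>1\<close>, for the history, and \<open>M\<close>, for the free orbit.\<close>
  define \<Gamma> where "\<Gamma> = integral {-\<tau>..0} (\<lambda>s. M * exp (\<omega> * \<tau>) * (b * \<bar>\<alpha> (s + \<tau>)\<bar> + \<eta>) + M * \<eta>) + \<gamma>"
  define \<rho> where "\<rho> = R / ((M + 1) * exp (\<Gamma> + \<omega> * \<tau>))"
  have "\<rho> > 0" using \<open>R > 0\<close> stability_const by (simp add: \<rho>_def)
  have \<rho>R: "(M + 1) * \<rho> * exp (\<Gamma> + \<omega> * \<tau>) = R" using stability_const by (simp add: \<rho>_def)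

  show ?thesis
  proof (intro exI[of _ \<rho>] conjI \<open>\<rho> > 0\<close> allI impI)
    fix f0 g0 :: "real \<Rightarrow> 'a"
    assume \<Phi>: "energy_continuous_on DV rA {-\<tau>..0} (\<lambda>s. (f0 s, g0 s))"
      and sup: "(SUP s\<in>{-\<tau>..0}. energy_norm rA (f0 s, g0 s)) < \<rho>"
    define \<phi> where "\<phi> t = emb (f0 (max (-\<tau>) t), g0 (max (-\<tau>) t))" for t
    have \<Phi>_cont: "continuous_on {-\<tau>..0} (\<lambda>s. emb (f0 s, g0 s))"
      and \<Phi>_mem: "\<And>s. s \<in> {-\<tau>..0} \<Longrightarrow> (f0 s, g0 s) \<in> energy_space DV"
      using \<Phi> by (auto simp: energy_continuous_on_def emb_def)
    have \<phi>_cont: "continuous_on {..0} \<phi>"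
      unfolding \<phi>_def using tau by (intro continuous_on_compose2[OF \<Phi>_cont] continuous_intros) auto
    have \<phi>_bound: "norm (\<phi> t) \<le> \<rho>" if "t \<le> 0" for t
    proof -
      have "bdd_above ((\<lambda>s. norm (emb (f0 s, g0 s))) ` {-\<tau>..0})"
        by (intro bounded_imp_bdd_above compact_imp_bounded compact_continuous_image
            continuous_intros \<Phi>_cont) auto
      then have "norm (\<phi> t) \<le> (SUP s\<in>{-\<tau>..0}. norm (emb (f0 s, g0 s)))"
        unfolding \<phi>_def using tau that by (intro cSUP_upper) auto
      then show ?thesis using sup by (simp add: norm_emb)
    qed
    interpret delayed_evolution \<Sigma> M \<omega> D "N \<psi>1" "N \<psi>2" \<alpha> \<tau> b \<phi>
    proof (intro delayed_evolution.intro sg delayed_evolution_axioms.intro)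
      show "0 \<le> b" unfolding b by (rule onorm_pos_le[OF BB])
      have "T 0 = 0" using linear_0[OF bounded_linear.linear[OF T(1)]] .
      then show "N \<psi>1 0 = 0" "N \<psi>2 0 = 0" by (simp_all add: N_def grad_zero zero_prod_def)
      show "\<exists>l\<ge>0. \<forall>x y. norm x \<le> R \<longrightarrow> norm y \<le> R \<longrightarrow>
          norm (N \<psi>1 x - N \<psi>1 y) \<le> l * norm (x - y) \<and> norm (N \<psi>2 x - N \<psi>2 y) \<le> l * norm (x - y)" for R
        using less_imp_le[OF L_pos[of "max R 1"]] lipschitz
        by (intro exI[of _ "L (max R 1)"] conjI allI impI N_lip) auto
    qed (use tau D_lin D_bound alpha_loc \<phi>_cont in auto)

    have growth_0: "growth \<eta> 0 + \<gamma> = \<Gamma>" by (simp add: growth_def rate_def[abs_def] \<Gamma>_def)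
    have growth_late: "growth \<eta> t - \<omega> * t \<le> \<Gamma> - \<delta> * t" if t: "0 \<le> t" for t
    proof (cases "t = 0")
      case True
      then show ?thesis using growth_0 gamma by simp
    next
      case False
      have \<alpha>_int: "(\<lambda>s. \<bar>\<alpha> (s + \<tau>)\<bar>) integrable_on {0..t}"
        using tau by (intro integrable_subinterval_real[OF abs_\<alpha>_shift_integrable[of t]]) auto
      have "growth \<eta> t = growth \<eta> 0 + integral {0..t} (rate \<eta>)"
        unfolding growth_def using t tau
        by (intro Henstock_Kurzweil_Integration.integral_combine[symmetric] rate_integrable) auto
      also have "integral {0..t} (rate \<eta>) =
          integral {0..t} (\<lambda>s. M * b * exp (\<omega> * \<tau>) * \<bar>\<alpha> (s + \<tau>)\<bar> + \<eta> * P)"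
        by (rule integral_cong) (simp add: rate_def P_def algebra_simps)
      also have "\<dots> = M * b * exp (\<omega> * \<tau>) * integral {0..t} (\<lambda>s. \<bar>\<alpha> (s + \<tau>)\<bar>) + \<eta> * P * t"
        using t by (subst integral_add) (auto intro!: integrable_on_mult_right \<alpha>_int)
      also have "\<dots> \<le> (\<gamma> + \<omega>' * t) + \<delta> * t"
        using alpha_growth[of t] False t \<eta>P by (intro add_mono mult_right_mono) auto
      finally have "growth \<eta> t \<le> \<Gamma> + (\<omega>' + \<delta>) * t" using growth_0 by (simp add: algebra_simps)
      moreover have "(\<omega>' + \<delta>) * t = \<omega> * t - \<delta> * t" by (simp add: \<delta>_def field_simps)
      ultimately show ?thesis by linarith
    qed
    have growth_early: "growth \<eta> t - \<omega> * t \<le> \<Gamma> + \<omega> * \<tau>" if t: "-\<tau> \<le> t" "t \<le> 0" for t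
    proof -
      have "growth \<eta> t \<le> growth \<eta> 0"
        unfolding growth_def using t \<open>\<eta> > 0\<close>
        by (intro integral_subset_le rate_integrable) (auto intro: rate_nonneg)
      moreover have "\<omega> * (- t) \<le> \<omega> * \<tau>" using t stability_const by (intro mult_left_mono) auto
      ultimately show ?thesis using growth_0 gamma by simp
    qed
    have growth_bound: "growth \<eta> t - \<omega> * t \<le> \<Gamma> + \<omega> * \<tau>" "growth \<eta> t - \<omega> * t \<le> \<Gamma> + \<omega> * \<tau> - \<delta> * t"
      if "-\<tau> \<le> t" for t
    proof -
      have "0 \<le> \<omega> * \<tau>" using stability_const tau by simp
      consider "0 \<le> t" "0 \<le> \<delta> * t" | "t \<le> 0" "\<delta> * t \<le> 0"
        using \<open>\<delta> > 0\<close> by (cases "0 \<le> t") (auto simp: mult_le_0_iff)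
      then have "growth \<eta> t - \<omega> * t \<le> \<Gamma> + \<omega> * \<tau> \<and> growth \<eta> t - \<omega> * t \<le> \<Gamma> + \<omega> * \<tau> - \<delta> * t"
      proof cases
        case 1 then show ?thesis using growth_late[of t] \<open>0 \<le> \<omega> * \<tau>\<close> by linarith
      next
        case 2 then show ?thesis using growth_early[OF that] by linarith
      qed
      then show "growth \<eta> t - \<omega> * t \<le> \<Gamma> + \<omega> * \<tau>" "growth \<eta> t - \<omega> * t \<le> \<Gamma> + \<omega> * \<tau> - \<delta> * t" by auto
    qed

    have M\<rho>: "\<rho> \<le> (M + 1) * \<rho>" "0 \<le> (M + 1) * \<rho>" "M * \<rho> \<le> (M + 1) * \<rho>"
      using \<open>\<rho> > 0\<close> stability_const by (auto simp: algebra_simps)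
    obtain u where u: "mild_solution u"
      and u_bound: "\<And>t. -\<tau> \<le> t \<Longrightarrow> norm (u t) \<le> (M + 1) * \<rho> * exp (growth \<eta> t - \<omega> * t)"
    proof (rule mild_solution_exists[of \<eta> R "(M + 1) * \<rho>"])
      show "norm (N \<psi>1 x - N \<psi>1 y) \<le> \<eta> * norm (x - y) \<and> norm (N \<psi>2 x - N \<psi>2 y) \<le> \<eta> * norm (x - y)"
        if "norm x \<le> R" "norm y \<le> R" for x y
        unfolding \<eta>_def using that \<open>R > 0\<close> lipschitz by (intro conjI N_lip) auto
      show "norm (\<phi> t) \<le> (M + 1) * \<rho>" if "t \<le> 0" for t using \<phi>_bound[OF that] M\<rho> by linarith
      show "M * norm (\<phi> 0) \<le> (M + 1) * \<rho>"
        using mult_left_mono[OF \<phi>_bound[of 0], of M] stability_const M\<rho> by linarith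
      show "(M + 1) * \<rho> * exp (growth \<eta> t - \<omega> * t) \<le> R" if "-\<tau> \<le> t" for t
        using growth_bound(1)[OF that] M\<rho>(2) by (subst \<rho>R[symmetric]) (intro mult_left_mono, auto)
    qed (use \<open>\<eta> > 0\<close> M\<rho> in auto)

    \<comment> \<open>Translation between the two formulations: \<open>U\<close> solves the wave problem if and only if
      \<open>emb \<circ> U\<close> solves the transported equation.\<close>
    have integrand_mem: "\<alpha> s *\<^sub>R delay_operator B (U (s - \<tau>)) + wave_nonlinearity DV \<psi>1 \<psi>2 (U s) (U (s - \<tau>))
        \<in> energy_space DV" for U s
      using subspace_0[OF rA(1)] by (simp add: delay_operator_def wave_nonlinearity_def energy_space_def)
    have integrand: "emb (S (t - s) (\<alpha> s *\<^sub>R delay_operator B (U (s - \<tau>))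
          + wave_nonlinearity DV \<psi>1 \<psi>2 (U s) (U (s - \<tau>)))) = \<Sigma> (t - s) (rhs (\<lambda>t. emb (U t)) s)"
      if "U s \<in> energy_space DV" "U (s - \<tau>) \<in> energy_space DV" for U s t
    proof -
      have "T 0 = 0" using linear_0[OF bounded_linear.linear[OF T(1)]] .
      then have "lift (rhs (\<lambda>t. emb (U t)) s) = \<alpha> s *\<^sub>R delay_operator B (U (s - \<tau>))
          + wave_nonlinearity DV \<psi>1 \<psi>2 (U s) (U (s - \<tau>))"
        using that by (auto simp: rhs_def D_def N_def lift_def emb_simps delay_operator_def
            wave_nonlinearity_def energy_space_def T)
      then show ?thesis by (simp add: \<Sigma>)
    qed
    have mild_emb: "mild_solution (\<lambda>t. emb (V t))"
      if V: "is_mild_solution DV rA S B \<psi>1 \<psi>2 \<alpha> \<tau> (\<lambda>s. (f0 s, g0 s)) V" for V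
      unfolding mild_solution_def
    proof (intro conjI ballI allI impI)
      have V_mem: "\<And>t. -\<tau> \<le> t \<Longrightarrow> V t \<in> energy_space DV"
        using V by (auto simp: is_mild_solution_def energy_continuous_on_def)
      show "continuous_on {-\<tau>..} (\<lambda>t. emb (V t))"
        using V by (auto simp: is_mild_solution_def energy_continuous_on_def emb_def)
      show "emb (V t) = \<phi> t" if "t \<in> {-\<tau>..0}" for t
        using V that by (auto simp: is_mild_solution_def \<phi>_def max_def)
      fix t :: real assume t: "0 \<le> t"
      have "((\<lambda>s. emb (S (t - s) (\<alpha> s *\<^sub>R delay_operator B (V (s - \<tau>))
          + wave_nonlinearity DV \<psi>1 \<psi>2 (V s) (V (s - \<tau>))))) has_integral emb (V t - S t (V 0))) {0..t}"
        using V t by (auto simp: is_mild_solution_def has_energy_integral_def emb_def)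
      moreover have "emb (V t - S t (V 0)) = emb (V t) - \<Sigma> t (emb (V 0))"
        using V_mem t tau S_mem by (simp add: emb_diff \<Sigma> lift_emb)
      ultimately show "((\<lambda>s. \<Sigma> (t - s) (rhs (\<lambda>t. emb (V t)) s)) has_integral
          (emb (V t) - \<Sigma> t (emb (V 0)))) {0..t}"
        using V_mem tau
        by (subst has_integral_cong[OF integrand[symmetric]]) auto
    qed

    define U where "U t = lift (u t)" for t
    have emb_U: "emb (U t) = u t" for t by (simp add: U_def emb_lift)
    have U_mem: "U t \<in> energy_space DV" for t by (simp add: U_def lift_mem)
    have U_solution: "is_mild_solution DV rA S B \<psi>1 \<psi>2 \<alpha> \<tau> (\<lambda>s. (f0 s, g0 s)) U"
      unfolding is_mild_solution_def
    proof (intro conjI ballI allI impI)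
      show "energy_continuous_on DV rA {-\<tau>..} U"
        using u U_mem by (simp add: energy_continuous_on_def emb_def[symmetric] emb_U mild_solution_def)
      show "U t = (f0 t, g0 t)" if "t \<in> {-\<tau>..0}" for t
        using u that \<Phi>_mem[OF that] by (simp add: U_def mild_solution_def \<phi>_def max_def lift_emb)
    next
      fix t :: real assume t: "0 \<le> t"
      show "has_energy_integral DV rA (\<lambda>s. S (t - s) (\<alpha> s *\<^sub>R delay_operator B (U (s - \<tau>))
          + wave_nonlinearity DV \<psi>1 \<psi>2 (U s) (U (s - \<tau>)))) (U t - S t (U 0)) {0..t}"
        unfolding has_energy_integral_def emb_def[symmetric]
      proof (intro conjI ballI)
        show "S (t - s) (\<alpha> s *\<^sub>R delay_operator B (U (s - \<tau>))
            + wave_nonlinearity DV \<psi>1 \<psi>2 (U s) (U (s - \<tau>))) \<in> energy_space DV" if "s \<in> {0..t}" for s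
          using that by (intro S_mem integrand_mem) auto
        show "U t - S t (U 0) \<in> energy_space DV" by (intro E_diff S_mem U_mem t)
        have "emb (U t - S t (U 0)) = u t - \<Sigma> t (u 0)"
          using U_mem S_mem[OF t] by (simp add: emb_diff emb_U \<Sigma>) (simp add: U_def)
        then show "((\<lambda>s. emb (S (t - s) (\<alpha> s *\<^sub>R delay_operator B (U (s - \<tau>))
            + wave_nonlinearity DV \<psi>1 \<psi>2 (U s) (U (s - \<tau>))))) has_integral emb (U t - S t (U 0))) {0..t}"
          using u t by (simp add: integrand U_mem emb_U mild_solution_def)
      qed
    next
      fix t :: real assume t: "0 \<le> t"
      have u_cont: "continuous_on {-\<tau>..} u" using u by (simp add: mild_solution_def)
      obtain \<beta> where \<beta>: "\<And>t. \<beta> integrable_on {0..t}" "\<And>s. norm (rhs u s) \<le> \<beta> s"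
        using rhs_integrable_majorant[OF u_cont] by blast
      have "((\<lambda>s. (T \<circ> fst) (u s)) has_vector_derivative snd (u t)) (at t within {0..})"
      proof (rule mild_solution_kinematics[of "T \<circ> fst" snd u "rhs u" \<beta>])
        show "bounded_linear (T \<circ> fst)"
          unfolding o_def by (rule bounded_linear_compose[OF T(1) bounded_linear_fst])
        show "(T \<circ> fst) (\<Sigma> t x) - (T \<circ> fst) x = integral {0..t} (\<lambda>s. snd (\<Sigma> s x))" if "0 \<le> t" for t x
          using kin[OF that] by simp
        show "continuous_on {0..} u" by (rule continuous_on_subset[OF u_cont]) (use tau in auto)
        show "(T \<circ> fst) (rhs u s) = 0" for s
          using linear_0[OF bounded_linear.linear[OF T(1)]] by (simp add: rhs_def D_def N_def)
      qed (use u t \<beta> in \<open>auto simp: mild_solution_def bounded_linear_snd\<close>)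
      then show "((\<lambda>s. fst (U s)) has_vector_derivative snd (U t)) (at t within {0..})"
        by (simp add: U_def lift_def)
    qed

    have unique: "V t = U t" if V: "is_mild_solution DV rA S B \<psi>1 \<psi>2 \<alpha> \<tau> (\<lambda>s. (f0 s, g0 s)) V" and "-\<tau> \<le> t" for V t
    proof -
      have "emb (V t) = u t" by (rule mild_solution_unique[OF mild_emb[OF V] u that(2)])
      moreover have "V t \<in> energy_space DV"
        using V that(2) by (auto simp: is_mild_solution_def energy_continuous_on_def)
      ultimately show ?thesis using lift_emb by (metis U_def)
    qed

    have U_decay: "energy_norm rA (U t) \<le> R * exp (- \<delta> * t)" if "-\<tau> \<le> t" for t
    proof -
      have "energy_norm rA (U t) \<le> (M + 1) * \<rho> * exp (growth \<eta> t - \<omega> * t)"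
        using u_bound[OF that] by (simp add: norm_emb[symmetric] emb_U)
      also have "\<dots> \<le> (M + 1) * \<rho> * exp (\<Gamma> + \<omega> * \<tau> + - \<delta> * t)"
        using growth_bound(2)[OF that] M\<rho>(2) by (intro mult_left_mono) auto
      also have "\<dots> = R * exp (- \<delta> * t)"
        by (simp only: exp_add[of "\<Gamma> + \<omega> * \<tau>"] \<rho>R mult.assoc[symmetric])
      finally show ?thesis .
    qed
    have "\<exists>Ctilde. \<forall>t\<ge>0. delay_energy DV rA B \<psi>1 \<psi>2 \<alpha> \<tau> U t \<le> Ctilde * exp (- (2 * \<delta>) * t)"
      by (rule delay_energy_decay[where h = h1 and L = L and \<sigma> = \<sigma>, OF sqrt_A B tau \<open>\<delta> > 0\<close> \<open>R > 0\<close>])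
        (rule abs_\<alpha>_integrable alpha_sigma gateaux psi_zero h1 grad_h1 lipschitz grad_zero L_pos
          U_mem U_decay | assumption)+
    then have decay: "\<exists>Ctilde. \<forall>t\<ge>0. delay_energy DV rA B \<psi>1 \<psi>2 \<alpha> \<tau> U t \<le> Ctilde * exp (- (\<omega> - \<omega>') * t)"
      by (simp only: two_\<delta>)
    show "\<exists>U. is_mild_solution DV rA S B \<psi>1 \<psi>2 \<alpha> \<tau> (\<lambda>s. (f0 s, g0 s)) U \<and>
          (\<forall>V. is_mild_solution DV rA S B \<psi>1 \<psi>2 \<alpha> \<tau> (\<lambda>s. (f0 s, g0 s)) V
                \<longrightarrow> (\<forall>t\<ge>-\<tau>. V t = U t)) \<and>
          (\<exists>Ctilde. \<forall>t\<ge>0. delay_energy DV rA B \<psi>1 \<psi>2 \<alpha> \<tau> U t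
                                \<le> Ctilde * exp (- (\<omega> - \<omega>') * t))"
      using U_solution unique decay by blast
  qed
qed

end
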